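(* Let $\mathcal{L}$ be a bounded first-order language, let $F\subseteq\mathcal{L}$, and let $R_F=\min_{\sqsubseteq_{\mathcal{L}}}\{c_{\mathcal{L}}(\phi)\mid\phi\in F\}$ be its representation. Then $\bigwedge R_F\equiv\bigwedge F$ (a state satisfies every formula of $R_F$ iff it satisfies every formula of $F$), and $\uparrow R_F=\uparrow F$.
   Context: Fix a first-order signature $\Sigma$ and a set of variables $V$. States are pairs $((\mathcal{U},\mathcal{I}),\mu)$ of a $\Sigma$-structure with finite universe and an assignment of the variables; satisfaction is standard, with $\bot$ false, $\bigvee/\bigwedge$ of a sequence being disjunction/conjunction of its elements, $\bigvee\epsilon\equiv\bot$. For finite $X\subseteq V$, $\mathfrak{S}_X$ is the set of permutations of $X$ and $\phi\pi$ replaces each free $x\in X$ by $\pi(x)$; a set of formulas is $\mathfrak{S}_V$-closed if closed under such substitutions. For $\bar\phi=\langle\phi_1,\dots,\phi_n\rangle$: $[\bar\phi]=\{1,\dots,n\}$, $\phi_{-i}=\phi_{n-i+1}$; $\epsilon$ empty sequence; $\mathcal{L}^*$ finite sequences. Bounded first-order languages (inductively, $X\subseteq V$ finite): $\mathcal{L}_A=A\cup\{\bot\}$ ($A$ finite $\mathfrak{S}_V$-closed set of formulas with free variables in $V$); $\mathcal{L}_1\vee\mathcal{L}_2$, $\mathcal{L}_1\wedge\mathcal{L}_2$ (formulas $\phi_1\circ\phi_2$, $\phi_i\in\mathcal{L}_i$); $\bigvee_k\mathcal{L}=\{\bigvee\bar\phi\mid|\bar\phi|\le k\}$; $\bigwedge_\omega\mathcal{L}=\{\bigwedge\bar\phi\mid\bar\phi\neq\epsilon\}$;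 $\exists_X\mathcal{L}$, $\forall_X\mathcal{L}$, $\exists\forall_X\mathcal{L}$ (formulas $QX.\phi$, $\phi\in\mathcal{L}$, with $Q=\exists$, $Q=\forall$, $Q\in\{\exists,\forall\}$ respectively). Subsumption: $\phi\sqsubseteq_{\mathcal{L}_A}\psi$ iff $\phi=\bot$ or $\phi=\psi$; pointwise for binary connectives; $\bigvee\bar\phi\sqsubseteq\bigvee\bar\psi$ iff some injective $m:[\bar\phi]\to[\bar\psi]$ has $\phi_i\sqsubseteq\psi_{m(i)}$ for all $i$; $\bigwedge\bar\phi\sqsubseteq\bigwedge\bar\psi$ iff some $m:[\bar\psi]\to[\bar\phi]$ has $\phi_{m(i)}\sqsubseteq\psi_i$ for all $i$; $QX.\phi\sqsubseteq QX.\psi$ iff $\phi\sqsubseteq\psi\pi$ for some $\pi\in\mathfrak{S}_X$; in $\exists\forall_X\mathcal{L}$ also $\forall X.\phi\sqsubseteq\exists X.\psi$ iff $\phi\sqsubseteq\psi\pi$ for some $\pi$ (and $\exists X.\phi\not\sqsubseteq\forall X.\psi$). Canonicalization $c_{\mathcal{L}}$ and total order $\le_{\mathcal{L}}$ on canonical formulas (mutual induction; $\min_{\sqsubseteq}$ = set of $\sqsubseteq$-minimal elements, $\min_{\le}$ = least element, $\mathrm{sort}_{\le}$ = ascending sort): $c_{\mathcal{L}_A}(\phi)=\phi$; $c(\phi_1\circ\phi_2)=c(\phi_1)\circ c(\phi_2)$; $c(\bigvee\bar\phi)=\bigvee\mathrm{sort}_{\le}\langle c(\phi_1),\dots,c(\phi_n)\rangle$;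 $c(\bigwedge\bar\phi)=\bigwedge\mathrm{sort}_{\le}(\min_{\sqsubseteq}\{c(\phi_1),\dots,c(\phi_n)\})$; $c(QX.\phi)=QX.\min_{\le}\{c(\phi\pi)\mid\pi\in\mathfrak{S}_X\}$. $\le_{\mathcal{L}_A}$ is any total order extending $\sqsubseteq_{\mathcal{L}_A}$; binary connectives ordered lexicographically; $\bigvee\bar\phi\le\bigvee\bar\psi$ iff $\bar\phi$ is a suffix of $\bar\psi$ or at the first index $i$ (counting from the end) where they differ, $\phi_{-i}<\psi_{-i}$; $\bigwedge\bar\phi\le\bigwedge\bar\psi$ iff $\bar\psi$ is a prefix of $\bar\phi$ or at the first index $i$ where they differ, $\phi_i<\psi_i$; $QX.\phi\le QX.\psi$ iff $\phi\le\psi$, and $\forall X.\phi<\exists X.\psi$ in $\exists\forall_X\mathcal{L}$. Upward closure: $\uparrow F=\{\phi\in\mathcal{L}\mid\exists\psi\in F.\ \psi\sqsubseteq_{\mathcal{L}}\phi\}$.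
   Formalization: A language may be quantified over X only if it is closed under permutations of X without variable capture (likewise the base sets A are closed without capture); otherwise, e.g. for the language "exists {x,y} exists {x} L_A", canonicalization can turn p(x,y) into p(x,x) and the claim fails. *)

theory Defs
  imports Main "HOL-Library.Sublist" "HOL-Library.Multiset" "HOL-Combinatorics.Permutations"
begin

section \<open>First-order logic over finite structures\<close>

datatype ('f, tm_vars: 'v) tm = Var 'v | Fun 'f "('f, 'v) tm list"

text \<open>The binary connectives and the connectives over finite sequences are distinct constructors,
  and quantifiers bind a whole set of variables.\<close>

datatype ('f, 'p, 'v) fm =
    Bot
  | Eq "('f, 'v) tm" "('f, 'v) tm"
  | Rel 'p "('f, 'v) tm list"
  | Neg "('f, 'p, 'v) fm"
  | Or "('f, 'p, 'v) fm" "('f, 'p, 'v) fm"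
  | And "('f, 'p, 'v) fm" "('f, 'p, 'v) fm"
  | BigOr "('f, 'p, 'v) fm list"
  | BigAnd "('f, 'p, 'v) fm list"
  | Exists "'v set" "('f, 'p, 'v) fm"
  | Forall "'v set" "('f, 'p, 'v) fm"

record ('f, 'p) signature =
  fun_arity :: "'f \<Rightarrow> nat"
  rel_arity :: "'p \<Rightarrow> nat"

fun wf_tm :: "('f, 'p) signature \<Rightarrow> ('f, 'v) tm \<Rightarrow> bool" where
  "wf_tm Sg (Var v) \<longleftrightarrow> True"
| "wf_tm Sg (Fun f ts) \<longleftrightarrow> length ts = fun_arity Sg f \<and> (\<forall>t\<in>set ts. wf_tm Sg t)"

fun wf_fm :: "('f, 'p) signature \<Rightarrow> ('f, 'p, 'v) fm \<Rightarrow> bool" where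
  "wf_fm Sg Bot \<longleftrightarrow> True"
| "wf_fm Sg (Eq s t) \<longleftrightarrow> wf_tm Sg s \<and> wf_tm Sg t"
| "wf_fm Sg (Rel p ts) \<longleftrightarrow> length ts = rel_arity Sg p \<and> (\<forall>t\<in>set ts. wf_tm Sg t)"
| "wf_fm Sg (Neg \<phi>) \<longleftrightarrow> wf_fm Sg \<phi>"
| "wf_fm Sg (Or \<phi> \<psi>) \<longleftrightarrow> wf_fm Sg \<phi> \<and> wf_fm Sg \<psi>"
| "wf_fm Sg (And \<phi> \<psi>) \<longleftrightarrow> wf_fm Sg \<phi> \<and> wf_fm Sg \<psi>"
| "wf_fm Sg (BigOr \<phi>s) \<longleftrightarrow> (\<forall>\<phi>\<in>set \<phi>s. wf_fm Sg \<phi>)"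
| "wf_fm Sg (BigAnd \<phi>s) \<longleftrightarrow> (\<forall>\<phi>\<in>set \<phi>s. wf_fm Sg \<phi>)"
| "wf_fm Sg (Exists X \<phi>) \<longleftrightarrow> finite X \<and> wf_fm Sg \<phi>"
| "wf_fm Sg (Forall X \<phi>) \<longleftrightarrow> finite X \<and> wf_fm Sg \<phi>"

fun fv :: "('f, 'p, 'v) fm \<Rightarrow> 'v set" where
  "fv Bot = {}"
| "fv (Eq s t) = tm_vars s \<union> tm_vars t"
| "fv (Rel p ts) = (\<Union>t\<in>set ts. tm_vars t)"
| "fv (Neg \<phi>) = fv \<phi>"
| "fv (Or \<phi> \<psi>) = fv \<phi> \<union> fv \<psi>"
| "fv (And \<phi> \<psi>) = fv \<phi> \<union> fv \<psi>"
| "fv (BigOr \<phi>s) = (\<Union>\<phi>\<in>set \<phi>s. fv \<phi>)"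
| "fv (BigAnd \<phi>s) = (\<Union>\<phi>\<in>set \<phi>s. fv \<phi>)"
| "fv (Exists X \<phi>) = fv \<phi> - X"
| "fv (Forall X \<phi>) = fv \<phi> - X"

record ('f, 'p, 'u) struct =
  univ :: "'u set"
  fun_int :: "'f \<Rightarrow> 'u list \<Rightarrow> 'u"
  rel_int :: "'p \<Rightarrow> 'u list \<Rightarrow> bool"

text \<open>A state is a structure with finite (and, as usual in first-order logic, nonempty) universe
  together with an assignment; the values of the assignment outside \<open>V\<close> are irrelevant.\<close>

definition is_state ::
  "('f, 'p) signature \<Rightarrow> 'v set \<Rightarrow> ('f, 'p, 'u) struct \<times> ('v \<Rightarrow> 'u) \<Rightarrow> bool" where
  "is_state Sg V = (\<lambda>(M, \<mu>). finite (univ M) \<and> univ M \<noteq> {} \<and>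
     (\<forall>f us. length us = fun_arity Sg f \<longrightarrow> set us \<subseteq> univ M \<longrightarrow> fun_int M f us \<in> univ M) \<and>
     (\<forall>v\<in>V. \<mu> v \<in> univ M))"

primrec tm_val :: "('f, 'p, 'u) struct \<Rightarrow> ('v \<Rightarrow> 'u) \<Rightarrow> ('f, 'v) tm \<Rightarrow> 'u" where
  "tm_val M \<mu> (Var v) = \<mu> v"
| "tm_val M \<mu> (Fun f ts) = fun_int M f (map (tm_val M \<mu>) ts)"

fun sat :: "('f, 'p, 'u) struct \<times> ('v \<Rightarrow> 'u) \<Rightarrow> ('f, 'p, 'v) fm \<Rightarrow> bool" where
  "sat (M, \<mu>) Bot \<longleftrightarrow> False"
| "sat (M, \<mu>) (Eq s t) \<longleftrightarrow> tm_val M \<mu> s = tm_val M \<mu> t"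
| "sat (M, \<mu>) (Rel p ts) \<longleftrightarrow> rel_int M p (map (tm_val M \<mu>) ts)"
| "sat (M, \<mu>) (Neg \<phi>) \<longleftrightarrow> \<not> sat (M, \<mu>) \<phi>"
| "sat (M, \<mu>) (Or \<phi> \<psi>) \<longleftrightarrow> sat (M, \<mu>) \<phi> \<or> sat (M, \<mu>) \<psi>"
| "sat (M, \<mu>) (And \<phi> \<psi>) \<longleftrightarrow> sat (M, \<mu>) \<phi> \<and> sat (M, \<mu>) \<psi>"
| "sat (M, \<mu>) (BigOr \<phi>s) \<longleftrightarrow> (\<exists>\<phi>\<in>set \<phi>s. sat (M, \<mu>) \<phi>)"
| "sat (M, \<mu>) (BigAnd \<phi>s) \<longleftrightarrow> (\<forall>\<phi>\<in>set \<phi>s. sat (M, \<mu>) \<phi>)"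
| "sat (M, \<mu>) (Exists X \<phi>) \<longleftrightarrow> (\<exists>\<nu>. (\<forall>v\<in>X. \<nu> v \<in> univ M) \<and> sat (M, override_on \<mu> \<nu> X) \<phi>)"
| "sat (M, \<mu>) (Forall X \<phi>) \<longleftrightarrow> (\<forall>\<nu>. (\<forall>v\<in>X. \<nu> v \<in> univ M) \<longrightarrow> sat (M, override_on \<mu> \<nu> X) \<phi>)"

section \<open>Renaming of free variables\<close>

text \<open>\<open>rename \<phi> \<pi>\<close> replaces the free occurrences only. It denotes the intended substitution instance
  when no replaced variable is captured, which is what \<open>free_for\<close> says; closure under permutations
  therefore includes this condition.\<close>

fun rename :: "('f, 'p, 'v) fm \<Rightarrow> ('v \<Rightarrow> 'v) \<Rightarrow> ('f, 'p, 'v) fm" where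
  "rename Bot \<pi> = Bot"
| "rename (Eq s t) \<pi> = Eq (map_tm id \<pi> s) (map_tm id \<pi> t)"
| "rename (Rel p ts) \<pi> = Rel p (map (map_tm id \<pi>) ts)"
| "rename (Neg \<phi>) \<pi> = Neg (rename \<phi> \<pi>)"
| "rename (Or \<phi> \<psi>) \<pi> = Or (rename \<phi> \<pi>) (rename \<psi> \<pi>)"
| "rename (And \<phi> \<psi>) \<pi> = And (rename \<phi> \<pi>) (rename \<psi> \<pi>)"
| "rename (BigOr \<phi>s) \<pi> = BigOr (map (\<lambda>\<phi>. rename \<phi> \<pi>) \<phi>s)"
| "rename (BigAnd \<phi>s) \<pi> = BigAnd (map (\<lambda>\<phi>. rename \<phi> \<pi>) \<phi>s)"
| "rename (Exists X \<phi>) \<pi> = Exists X (rename \<phi> (override_on \<pi> id X))"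
| "rename (Forall X \<phi>) \<pi> = Forall X (rename \<phi> (override_on \<pi> id X))"

fun free_for :: "('v \<Rightarrow> 'v) \<Rightarrow> ('f, 'p, 'v) fm \<Rightarrow> bool" where
  "free_for \<pi> Bot \<longleftrightarrow> True"
| "free_for \<pi> (Eq s t) \<longleftrightarrow> True"
| "free_for \<pi> (Rel p ts) \<longleftrightarrow> True"
| "free_for \<pi> (Neg \<phi>) \<longleftrightarrow> free_for \<pi> \<phi>"
| "free_for \<pi> (Or \<phi> \<psi>) \<longleftrightarrow> free_for \<pi> \<phi> \<and> free_for \<pi> \<psi>"
| "free_for \<pi> (And \<phi> \<psi>) \<longleftrightarrow> free_for \<pi> \<phi> \<and> free_for \<pi> \<psi>"
| "free_for \<pi> (BigOr \<phi>s) \<longleftrightarrow> (\<forall>\<phi>\<in>set \<phi>s. free_for \<pi> \<phi>)"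
| "free_for \<pi> (BigAnd \<phi>s) \<longleftrightarrow> (\<forall>\<phi>\<in>set \<phi>s. free_for \<pi> \<phi>)"
| "free_for \<pi> (Exists X \<phi>) \<longleftrightarrow> \<pi> ` (fv \<phi> - X) \<inter> X = {} \<and> free_for (override_on \<pi> id X) \<phi>"
| "free_for \<pi> (Forall X \<phi>) \<longleftrightarrow> \<pi> ` (fv \<phi> - X) \<inter> X = {} \<and> free_for (override_on \<pi> id X) \<phi>"

definition perm_closed :: "'v set \<Rightarrow> ('f, 'p, 'v) fm set \<Rightarrow> bool" where
  "perm_closed V S \<longleftrightarrow>
     (\<forall>X \<pi> \<phi>. finite X \<and> X \<subseteq> V \<and> \<pi> permutes X \<and> \<phi> \<in> S \<longrightarrow> free_for \<pi> \<phi> \<and> rename \<phi> \<pi> \<in> S)"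

section \<open>Bounded first-order languages\<close>

text \<open>Subsumption, order and canonicalization depend on how a language is built, so a language is
  represented by its construction; \<open>fms\<close> is the set of its formulas.\<close>

datatype ('f, 'p, 'v) lang =
    LBase "('f, 'p, 'v) fm set"
  | LOr "('f, 'p, 'v) lang" "('f, 'p, 'v) lang"
  | LAnd "('f, 'p, 'v) lang" "('f, 'p, 'v) lang"
  | LBigOr nat "('f, 'p, 'v) lang"
  | LBigAnd "('f, 'p, 'v) lang"
  | LEx "'v set" "('f, 'p, 'v) lang"
  | LAll "'v set" "('f, 'p, 'v) lang"
  | LExAll "'v set" "('f, 'p, 'v) lang"

primrec fms :: "('f, 'p, 'v) lang \<Rightarrow> ('f, 'p, 'v) fm set" where
  "fms (LBase A) = A \<union> {Bot}"
| "fms (LOr L1 L2) = {Or \<phi> \<psi> | \<phi> \<psi>. \<phi> \<in> fms L1 \<and> \<psi> \<in> fms L2}"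
| "fms (LAnd L1 L2) = {And \<phi> \<psi> | \<phi> \<psi>. \<phi> \<in> fms L1 \<and> \<psi> \<in> fms L2}"
| "fms (LBigOr k L) = {BigOr \<phi>s | \<phi>s. set \<phi>s \<subseteq> fms L \<and> length \<phi>s \<le> k}"
| "fms (LBigAnd L) = {BigAnd \<phi>s | \<phi>s. set \<phi>s \<subseteq> fms L \<and> \<phi>s \<noteq> []}"
| "fms (LEx X L) = {Exists X \<phi> | \<phi>. \<phi> \<in> fms L}"
| "fms (LAll X L) = {Forall X \<phi> | \<phi>. \<phi> \<in> fms L}"
| "fms (LExAll X L) = {Exists X \<phi> | \<phi>. \<phi> \<in> fms L} \<union> {Forall X \<phi> | \<phi>. \<phi> \<in> fms L}"

definition atom_set :: "('f, 'p) signature \<Rightarrow> 'v set \<Rightarrow> ('f, 'p, 'v) fm set \<Rightarrow> bool" where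
  "atom_set Sg V A \<longleftrightarrow> finite A \<and> perm_closed V A \<and> (\<forall>\<phi>\<in>A. wf_fm Sg \<phi> \<and> fv \<phi> \<subseteq> V)"

text \<open>Subsumption and canonicalization of \<open>QX. \<phi>\<close> use the formulas \<open>\<phi>\<pi>\<close>, for \<open>\<pi>\<close> a permutation
  of \<open>X\<close>, as formulas of the language below the quantifier. Quantification over \<open>X\<close> is therefore
  formed only over languages closed under permutations of \<open>X\<close>. By \<open>perm_closed_if_disjoint\<close> below,
  this is automatic unless a variable of \<open>X\<close> is quantified again inside; \<open>X\<close> may also be
  requantified as a whole, since its variables are then no longer free.\<close>

primrec bounded_language :: "('f, 'p) signature \<Rightarrow> 'v set \<Rightarrow> ('f, 'p, 'v) lang \<Rightarrow> bool" where
  "bounded_language Sg V (LBase A) \<longleftrightarrow> atom_set Sg V A"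
| "bounded_language Sg V (LOr L1 L2) \<longleftrightarrow> bounded_language Sg V L1 \<and> bounded_language Sg V L2"
| "bounded_language Sg V (LAnd L1 L2) \<longleftrightarrow> bounded_language Sg V L1 \<and> bounded_language Sg V L2"
| "bounded_language Sg V (LBigOr k L) \<longleftrightarrow> bounded_language Sg V L"
| "bounded_language Sg V (LBigAnd L) \<longleftrightarrow> bounded_language Sg V L"
| "bounded_language Sg V (LEx X L) \<longleftrightarrow>
     finite X \<and> X \<subseteq> V \<and> bounded_language Sg V L \<and> perm_closed X (fms L)"
| "bounded_language Sg V (LAll X L) \<longleftrightarrow>
     finite X \<and> X \<subseteq> V \<and> bounded_language Sg V L \<and> perm_closed X (fms L)"
| "bounded_language Sg V (LExAll X L) \<longleftrightarrow>
     finite X \<and> X \<subseteq> V \<and> bounded_language Sg V L \<and> perm_closed X (fms L)"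

primrec qvars :: "('f, 'p, 'v) lang \<Rightarrow> 'v set" where
  "qvars (LBase A) = {}"
| "qvars (LOr L1 L2) = qvars L1 \<union> qvars L2"
| "qvars (LAnd L1 L2) = qvars L1 \<union> qvars L2"
| "qvars (LBigOr k L) = qvars L"
| "qvars (LBigAnd L) = qvars L"
| "qvars (LEx X L) = X \<union> qvars L"
| "qvars (LAll X L) = X \<union> qvars L"
| "qvars (LExAll X L) = X \<union> qvars L"

lemma perm_closed_if_disjoint:
  fixes L :: "('f, 'p, 'v) lang"
  assumes "bounded_language Sg V L" "X \<subseteq> V" "X \<inter> qvars L = {}"
  shows "perm_closed X (fms L)"
proof -
  have off: "override_on \<pi> id Y = \<pi>" if "\<pi> permutes Z" "Z \<inter> Y = {}" for \<pi> :: "'v \<Rightarrow> 'v" and Y Z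
    using that by (fastforce simp: override_on_def permutes_def)
  have nocap: "\<pi> ` (S - Y) \<inter> Y = {}" if "\<pi> permutes Z" "Z \<inter> Y = {}" for \<pi> :: "'v \<Rightarrow> 'v" and S Y Z
    using that by (auto simp: disjoint_iff) (metis permutes_in_image permutes_not_in)
  have *: "free_for \<pi> \<phi> \<and> rename \<phi> \<pi> \<in> fms L"
    if "finite Z" "\<pi> permutes Z" "Z \<subseteq> V" "Z \<inter> qvars L = {}" "\<phi> \<in> fms L" "bounded_language Sg V L"
    for Z \<pi> \<phi>
    using that
  proof (induction L arbitrary: \<phi>)
    case (LBase A)
    then show ?case by (auto simp: atom_set_def perm_closed_def)
  next
    case (LOr L1 L2)
    then show ?case by (fastforce simp: Int_Un_distrib)
  next
    case (LAnd L1 L2)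
    then show ?case by (fastforce simp: Int_Un_distrib)
  next
    case (LBigOr k L)
    then show ?case by fastforce
  next
    case (LBigAnd L)
    then show ?case by fastforce
  next
    case (LEx Y L)
    then have "Z \<inter> Y = {}" "Z \<inter> qvars L = {}" by auto
    with LEx off[OF LEx.prems(2), of Y] nocap[OF LEx.prems(2), of Y] show ?case by fastforce
  next
    case (LAll Y L)
    then have "Z \<inter> Y = {}" "Z \<inter> qvars L = {}" by auto
    with LAll off[OF LAll.prems(2), of Y] nocap[OF LAll.prems(2), of Y] show ?case by fastforce
  next
    case (LExAll Y L)
    then have "Z \<inter> Y = {}" "Z \<inter> qvars L = {}" by auto
    with LExAll off[OF LExAll.prems(2), of Y] nocap[OF LExAll.prems(2), of Y]
    show ?case by fastforce
  qed
  show ?thesis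
    unfolding perm_closed_def
  proof (intro allI impI, elim conjE)
    fix Z \<pi> \<phi>
    assume "finite Z" "Z \<subseteq> X" "\<pi> permutes Z" "\<phi> \<in> fms L"
    moreover from this assms have "Z \<subseteq> V" "Z \<inter> qvars L = {}" by auto
    ultimately show "free_for \<pi> \<phi> \<and> rename \<phi> \<pi> \<in> fms L" using * assms(1) by blast
  qed
qed

section \<open>Subsumption\<close>

primrec subsumes :: "('f, 'p, 'v) lang \<Rightarrow> ('f, 'p, 'v) fm \<Rightarrow> ('f, 'p, 'v) fm \<Rightarrow> bool" where
  "subsumes (LBase A) \<phi> \<psi> \<longleftrightarrow> \<phi> = Bot \<or> \<phi> = \<psi>"
| "subsumes (LOr L1 L2) \<phi> \<psi> \<longleftrightarrow>
     (\<exists>\<phi>1 \<phi>2 \<psi>1 \<psi>2. \<phi> = Or \<phi>1 \<phi>2 \<and> \<psi> = Or \<psi>1 \<psi>2 \<and> subsumes L1 \<phi>1 \<psi>1 \<and> subsumes L2 \<phi>2 \<psi>2)"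
| "subsumes (LAnd L1 L2) \<phi> \<psi> \<longleftrightarrow>
     (\<exists>\<phi>1 \<phi>2 \<psi>1 \<psi>2. \<phi> = And \<phi>1 \<phi>2 \<and> \<psi> = And \<psi>1 \<psi>2 \<and> subsumes L1 \<phi>1 \<psi>1 \<and> subsumes L2 \<phi>2 \<psi>2)"
| "subsumes (LBigOr k L) \<phi> \<psi> \<longleftrightarrow>
     (\<exists>\<phi>s \<psi>s. \<phi> = BigOr \<phi>s \<and> \<psi> = BigOr \<psi>s \<and>
        (\<exists>m. inj_on m {..<length \<phi>s} \<and>
           (\<forall>i<length \<phi>s. m i < length \<psi>s \<and> subsumes L (\<phi>s ! i) (\<psi>s ! m i))))"
| "subsumes (LBigAnd L) \<phi> \<psi> \<longleftrightarrow>
     (\<exists>\<phi>s \<psi>s. \<phi> = BigAnd \<phi>s \<and> \<psi> = BigAnd \<psi>s \<and>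
        (\<exists>m. \<forall>i<length \<psi>s. m i < length \<phi>s \<and> subsumes L (\<phi>s ! m i) (\<psi>s ! i)))"
| "subsumes (LEx X L) \<phi> \<psi> \<longleftrightarrow>
     (\<exists>\<phi>' \<psi>'. \<phi> = Exists X \<phi>' \<and> \<psi> = Exists X \<psi>' \<and>
        (\<exists>\<pi>. \<pi> permutes X \<and> subsumes L \<phi>' (rename \<psi>' \<pi>)))"
| "subsumes (LAll X L) \<phi> \<psi> \<longleftrightarrow>
     (\<exists>\<phi>' \<psi>'. \<phi> = Forall X \<phi>' \<and> \<psi> = Forall X \<psi>' \<and>
        (\<exists>\<pi>. \<pi> permutes X \<and> subsumes L \<phi>' (rename \<psi>' \<pi>)))"
| "subsumes (LExAll X L) \<phi> \<psi> \<longleftrightarrow>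
     (\<exists>\<phi>' \<psi>'. (\<phi> = Exists X \<phi>' \<and> \<psi> = Exists X \<psi>' \<or> \<phi> = Forall X \<phi>' \<and> \<psi> = Forall X \<psi>' \<or>
                \<phi> = Forall X \<phi>' \<and> \<psi> = Exists X \<psi>') \<and>
        (\<exists>\<pi>. \<pi> permutes X \<and> subsumes L \<phi>' (rename \<psi>' \<pi>)))"

section \<open>Order and canonicalization\<close>

definition first_diff_less :: "('a \<Rightarrow> 'a \<Rightarrow> bool) \<Rightarrow> 'a list \<Rightarrow> 'a list \<Rightarrow> bool" where
  "first_diff_less le xs ys \<longleftrightarrow>
     (\<exists>i. i < length xs \<and> i < length ys \<and> (\<forall>j<i. xs ! j = ys ! j) \<and>
          xs ! i \<noteq> ys ! i \<and> le (xs ! i) (ys ! i))"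

text \<open>\<open>ord A\<close> is the chosen total order on \<open>A \<union> {\<bottom>}\<close>. The relation \<open>lang_le ord L\<close> is defined
  on all formulas but is meant for canonical formulas of \<open>L\<close> only.\<close>

primrec lang_le :: "(('f, 'p, 'v) fm set \<Rightarrow> ('f, 'p, 'v) fm rel) \<Rightarrow> ('f, 'p, 'v) lang \<Rightarrow>
    ('f, 'p, 'v) fm \<Rightarrow> ('f, 'p, 'v) fm \<Rightarrow> bool" where
  "lang_le ord (LBase A) \<phi> \<psi> \<longleftrightarrow> (\<phi>, \<psi>) \<in> ord A"
| "lang_le ord (LOr L1 L2) \<phi> \<psi> \<longleftrightarrow>
     (\<exists>\<phi>1 \<phi>2 \<psi>1 \<psi>2. \<phi> = Or \<phi>1 \<phi>2 \<and> \<psi> = Or \<psi>1 \<psi>2 \<and>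
        (\<phi>1 \<noteq> \<psi>1 \<and> lang_le ord L1 \<phi>1 \<psi>1 \<or> \<phi>1 = \<psi>1 \<and> lang_le ord L2 \<phi>2 \<psi>2))"
| "lang_le ord (LAnd L1 L2) \<phi> \<psi> \<longleftrightarrow>
     (\<exists>\<phi>1 \<phi>2 \<psi>1 \<psi>2. \<phi> = And \<phi>1 \<phi>2 \<and> \<psi> = And \<psi>1 \<psi>2 \<and>
        (\<phi>1 \<noteq> \<psi>1 \<and> lang_le ord L1 \<phi>1 \<psi>1 \<or> \<phi>1 = \<psi>1 \<and> lang_le ord L2 \<phi>2 \<psi>2))"
| "lang_le ord (LBigOr k L) \<phi> \<psi> \<longleftrightarrow>
     (\<exists>\<phi>s \<psi>s. \<phi> = BigOr \<phi>s \<and> \<psi> = BigOr \<psi>s \<and>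
        (suffix \<phi>s \<psi>s \<or> first_diff_less (lang_le ord L) (rev \<phi>s) (rev \<psi>s)))"
| "lang_le ord (LBigAnd L) \<phi> \<psi> \<longleftrightarrow>
     (\<exists>\<phi>s \<psi>s. \<phi> = BigAnd \<phi>s \<and> \<psi> = BigAnd \<psi>s \<and>
        (prefix \<psi>s \<phi>s \<or> first_diff_less (lang_le ord L) \<phi>s \<psi>s))"
| "lang_le ord (LEx X L) \<phi> \<psi> \<longleftrightarrow>
     (\<exists>\<phi>' \<psi>'. \<phi> = Exists X \<phi>' \<and> \<psi> = Exists X \<psi>' \<and> lang_le ord L \<phi>' \<psi>')"
| "lang_le ord (LAll X L) \<phi> \<psi> \<longleftrightarrow>
     (\<exists>\<phi>' \<psi>'. \<phi> = Forall X \<phi>' \<and> \<psi> = Forall X \<psi>' \<and> lang_le ord L \<phi>' \<psi>')"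
| "lang_le ord (LExAll X L) \<phi> \<psi> \<longleftrightarrow>
     (\<exists>\<phi>' \<psi>'. \<phi> = Exists X \<phi>' \<and> \<psi> = Exists X \<psi>' \<and> lang_le ord L \<phi>' \<psi>' \<or>
              \<phi> = Forall X \<phi>' \<and> \<psi> = Forall X \<psi>' \<and> lang_le ord L \<phi>' \<psi>' \<or>
              \<phi> = Forall X \<phi>' \<and> \<psi> = Exists X \<psi>')"

definition base_orders ::
  "('f, 'p) signature \<Rightarrow> 'v set \<Rightarrow> (('f, 'p, 'v) fm set \<Rightarrow> ('f, 'p, 'v) fm rel) \<Rightarrow> bool" where
  "base_orders Sg V ord \<longleftrightarrow>
     (\<forall>A. atom_set Sg V A \<longrightarrow> linear_order_on (fms (LBase A)) (ord A) \<and>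
        (\<forall>\<phi>\<in>fms (LBase A). \<forall>\<psi>\<in>fms (LBase A). subsumes (LBase A) \<phi> \<psi> \<longrightarrow> (\<phi>, \<psi>) \<in> ord A))"

definition minimals :: "('a \<Rightarrow> 'a \<Rightarrow> bool) \<Rightarrow> 'a set \<Rightarrow> 'a set" where
  "minimals le S = {x \<in> S. \<forall>y\<in>S. le y x \<longrightarrow> y = x}"

definition least_wrt :: "('a \<Rightarrow> 'a \<Rightarrow> bool) \<Rightarrow> 'a set \<Rightarrow> 'a" where
  "least_wrt le S = (THE x. x \<in> S \<and> (\<forall>y\<in>S. le x y))"

definition sort_list_wrt :: "('a \<Rightarrow> 'a \<Rightarrow> bool) \<Rightarrow> 'a list \<Rightarrow> 'a list" where
  "sort_list_wrt le xs = (THE ys. mset ys = mset xs \<and> sorted_wrt le ys)"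

definition sort_set_wrt :: "('a \<Rightarrow> 'a \<Rightarrow> bool) \<Rightarrow> 'a set \<Rightarrow> 'a list" where
  "sort_set_wrt le S = (THE ys. set ys = S \<and> distinct ys \<and> sorted_wrt le ys)"

text \<open>Arguments outside \<open>fms L\<close> are irrelevant and returned unchanged.\<close>

primrec canon :: "(('f, 'p, 'v) fm set \<Rightarrow> ('f, 'p, 'v) fm rel) \<Rightarrow> ('f, 'p, 'v) lang \<Rightarrow>
    ('f, 'p, 'v) fm \<Rightarrow> ('f, 'p, 'v) fm" where
  "canon ord (LBase A) \<phi> = \<phi>"
| "canon ord (LOr L1 L2) \<phi> =
     (case \<phi> of Or \<phi>1 \<phi>2 \<Rightarrow> Or (canon ord L1 \<phi>1) (canon ord L2 \<phi>2) | _ \<Rightarrow> \<phi>)"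
| "canon ord (LAnd L1 L2) \<phi> =
     (case \<phi> of And \<phi>1 \<phi>2 \<Rightarrow> And (canon ord L1 \<phi>1) (canon ord L2 \<phi>2) | _ \<Rightarrow> \<phi>)"
| "canon ord (LBigOr k L) \<phi> =
     (case \<phi> of BigOr \<phi>s \<Rightarrow> BigOr (sort_list_wrt (lang_le ord L) (map (canon ord L) \<phi>s)) | _ \<Rightarrow> \<phi>)"
| "canon ord (LBigAnd L) \<phi> =
     (case \<phi> of BigAnd \<phi>s \<Rightarrow>
        BigAnd (sort_set_wrt (lang_le ord L) (minimals (subsumes L) (canon ord L ` set \<phi>s)))
      | _ \<Rightarrow> \<phi>)"
| "canon ord (LEx X L) \<phi> =
     (case \<phi> of Exists _ \<psi> \<Rightarrow>
        Exists X (least_wrt (lang_le ord L) {canon ord L (rename \<psi> \<pi>) | \<pi>. \<pi> permutes X})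
      | _ \<Rightarrow> \<phi>)"
| "canon ord (LAll X L) \<phi> =
     (case \<phi> of Forall _ \<psi> \<Rightarrow>
        Forall X (least_wrt (lang_le ord L) {canon ord L (rename \<psi> \<pi>) | \<pi>. \<pi> permutes X})
      | _ \<Rightarrow> \<phi>)"
| "canon ord (LExAll X L) \<phi> =
     (case \<phi> of
        Exists _ \<psi> \<Rightarrow> Exists X (least_wrt (lang_le ord L) {canon ord L (rename \<psi> \<pi>) | \<pi>. \<pi> permutes X})
      | Forall _ \<psi> \<Rightarrow> Forall X (least_wrt (lang_le ord L) {canon ord L (rename \<psi> \<pi>) | \<pi>. \<pi> permutes X})
      | _ \<Rightarrow> \<phi>)"

section \<open>Representations and upward closure\<close>

definition representation :: "(('f, 'p, 'v) fm set \<Rightarrow> ('f, 'p, 'v) fm rel) \<Rightarrow> ('f, 'p, 'v) lang \<Rightarrow>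
    ('f, 'p, 'v) fm set \<Rightarrow> ('f, 'p, 'v) fm set" where
  "representation ord L F = minimals (subsumes L) (canon ord L ` F)"

definition up_closure :: "('f, 'p, 'v) lang \<Rightarrow> ('f, 'p, 'v) fm set \<Rightarrow> ('f, 'p, 'v) fm set" where
  "up_closure L F = {\<phi> \<in> fms L. \<exists>\<psi>\<in>F. subsumes L \<psi> \<phi>}"

end

theory Submission imports Defs begin

text \<open>Subsumption is a preorder that implies semantic consequence, and every formula \<open>\<phi>\<close> is
  subsumption-equivalent to \<open>c(\<phi>)\<close>. Hence only the passage from \<open>c(F)\<close> to its minimal elements
  needs an argument: every element of \<open>c(F)\<close> must lie above a minimal one. This holds because there
  are only finitely many canonical formulas and subsumption is antisymmetric on them, being contained
  in the linear order \<open>\<le>\<close>. The containment is proved by induction on the language.\<close>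

section \<open>Renaming\<close>

text \<open>Below a quantifier, subsumption is taken up to a permutation of the bound variables, so
  transitivity and the equivalence of a formula with its canonical form come down to composing and
  inverting permutations. This works only if renaming both sides preserves subsumption. The renaming
  must then pass through inner quantifiers, where it loses its action on the bound variables and
  must avoid capture.

  The containment of subsumption in the order is not inductive by itself. At a quantifier the
  canonical body is the least candidate, and comparing two such bodies requires that equivalent
  formulas of the inner language have equal canonical forms. Linearity of the order, equivalence
  with the canonical form and the containment are therefore proved together.

  The two sequence connectives have mirrored orders. An injective matching of disjuncts bounds the
  largest entries of one sequence by those of the other, so comparison starts at the end and longer
  means larger. A conjunction grows stronger with more conjuncts, so comparison starts at the least
  entries and longer means smaller.\<close>

lemma map_tm_cong_vars:
  "(\<And>v. v \<in> tm_vars t \<Longrightarrow> \<pi> v = \<sigma> v) \<Longrightarrow> map_tm id \<pi> t = map_tm id \<sigma> t"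
  by (rule tm.map_cong) auto

lemma rename_cong: "(\<And>v. v \<in> fv \<phi> \<Longrightarrow> \<pi> v = \<sigma> v) \<Longrightarrow> rename \<phi> \<pi> = rename \<phi> \<sigma>"
proof (induction \<phi> arbitrary: \<pi> \<sigma>)
  case Bot
  then show ?case by simp
next
  case (Eq s t)
  then show ?case using map_tm_cong_vars[of s \<pi> \<sigma>] map_tm_cong_vars[of t \<pi> \<sigma>] by simp
next
  case (Rel p ts)
  then show ?case by (auto intro!: map_tm_cong_vars)
next
  case (Neg \<phi>)
  from Neg.IH[of \<pi> \<sigma>] Neg.prems show ?case by simp
next
  case (Or \<phi> \<psi>)
  from Or.IH(1)[of \<pi> \<sigma>] Or.IH(2)[of \<pi> \<sigma>] Or.prems show ?case by simp
next
  case (And \<phi> \<psi>)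
  from And.IH(1)[of \<pi> \<sigma>] And.IH(2)[of \<pi> \<sigma>] And.prems show ?case by simp
next
  case (BigOr \<phi>s)
  have "rename \<phi> \<pi> = rename \<phi> \<sigma>" if "\<phi> \<in> set \<phi>s" for \<phi>
    using that by (intro BigOr.IH BigOr.prems) auto
  then show ?case by simp
next
  case (BigAnd \<phi>s)
  have "rename \<phi> \<pi> = rename \<phi> \<sigma>" if "\<phi> \<in> set \<phi>s" for \<phi>
    using that by (intro BigAnd.IH BigAnd.prems) auto
  then show ?case by simp
next
  case (Exists X \<phi>)
  have "rename \<phi> (override_on \<pi> id X) = rename \<phi> (override_on \<sigma> id X)"
    by (intro Exists.IH) (simp add: override_on_def Exists.prems)
  then show ?case by simp
next
  case (Forall X \<phi>)
  have "rename \<phi> (override_on \<pi> id X) = rename \<phi> (override_on \<sigma> id X)"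
    by (intro Forall.IH) (simp add: override_on_def Forall.prems)
  then show ?case by simp
qed

lemma rename_id [simp]: "rename \<phi> id = \<phi>"
proof (induction \<phi>)
  case (Exists X \<phi>)
  moreover have "override_on id id X = id" by (auto simp: override_on_def)
  ultimately show ?case by (simp del: id_apply)
next
  case (Forall X \<phi>)
  moreover have "override_on id id X = id" by (auto simp: override_on_def)
  ultimately show ?case by (simp del: id_apply)
qed (simp_all add: tm.map_id map_idI del: id_apply)

text \<open>On X both maps are the identity. A free variable outside X is sent by \<pi> to a
  variable outside X, where masking \<rho> changes nothing.\<close>

lemma rename_override_comp:
  assumes "\<pi> ` (fv \<phi> - X) \<inter> X = {}"
  shows "rename \<phi> (override_on \<rho> id X \<circ> override_on \<pi> id X) = rename \<phi> (override_on (\<rho> \<circ> \<pi>) id X)"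
  using assms by (intro rename_cong) (auto simp: override_on_def)

text \<open>A variable captured by the first renaming would be out of reach for the second, while
  the composite would still move it; \<open>free_for\<close> excludes this.\<close>

lemma rename_rename: "free_for \<pi> \<phi> \<Longrightarrow> rename (rename \<phi> \<pi>) \<rho> = rename \<phi> (\<rho> \<circ> \<pi>)"
proof (induction \<phi> arbitrary: \<pi> \<rho>)
  case (Exists X \<phi>)
  then show ?case by (simp add: rename_override_comp del: comp_apply)
next
  case (Forall X \<phi>)
  then show ?case by (simp add: rename_override_comp del: comp_apply)
qed (auto simp: tm.map_comp o_def id_def)

section \<open>Satisfaction\<close>

lemma tm_val_cong: "(\<And>v. v \<in> tm_vars t \<Longrightarrow> \<mu> v = \<nu> v) \<Longrightarrow> tm_val M \<mu> t = tm_val M \<nu> t"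
proof (induction t)
  case (Fun f ts)
  then have "map (tm_val M \<mu>) ts = map (tm_val M \<nu>) ts" by (auto intro!: Fun.IH)
  then show ?case by (simp only: tm_val.simps)
qed simp

lemma tm_val_map_tm: "tm_val M \<mu> (map_tm id \<pi> t) = tm_val M (\<mu> \<circ> \<pi>) t"
proof (induction t)
  case (Fun f ts)
  then show ?case by (simp add: o_def id_def cong: map_cong)
qed simp

lemma sat_cong: "(\<And>v. v \<in> fv \<phi> \<Longrightarrow> \<mu> v = \<nu> v) \<Longrightarrow> sat (M, \<mu>) \<phi> \<longleftrightarrow> sat (M, \<nu>) \<phi>"
proof (induction \<phi> arbitrary: \<mu> \<nu>)
  case Bot
  then show ?case by simp
next
  case (Eq s t)
  then show ?case using tm_val_cong[of s \<mu> \<nu> M] tm_val_cong[of t \<mu> \<nu> M] by simp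
next
  case (Rel p ts)
  then have "map (tm_val M \<mu>) ts = map (tm_val M \<nu>) ts" by (auto intro!: tm_val_cong)
  then show ?case by (simp only: sat.simps)
next
  case (Neg \<phi>)
  from Neg.IH[of \<mu> \<nu>] Neg.prems show ?case by simp
next
  case (Or \<phi> \<psi>)
  from Or.IH(1)[of \<mu> \<nu>] Or.IH(2)[of \<mu> \<nu>] Or.prems show ?case by simp
next
  case (And \<phi> \<psi>)
  from And.IH(1)[of \<mu> \<nu>] And.IH(2)[of \<mu> \<nu>] And.prems show ?case by simp
next
  case (BigOr \<phi>s)
  have "sat (M, \<mu>) \<phi> \<longleftrightarrow> sat (M, \<nu>) \<phi>" if "\<phi> \<in> set \<phi>s" for \<phi>
    using that by (intro BigOr.IH BigOr.prems) auto
  then show ?case by simp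
next
  case (BigAnd \<phi>s)
  have "sat (M, \<mu>) \<phi> \<longleftrightarrow> sat (M, \<nu>) \<phi>" if "\<phi> \<in> set \<phi>s" for \<phi>
    using that by (intro BigAnd.IH BigAnd.prems) auto
  then show ?case by simp
next
  case (Exists X \<phi>)
  have "sat (M, override_on \<mu> \<kappa> X) \<phi> \<longleftrightarrow> sat (M, override_on \<nu> \<kappa> X) \<phi>" for \<kappa>
    by (intro Exists.IH) (simp add: override_on_def Exists.prems)
  then show ?case by simp
next
  case (Forall X \<phi>)
  have "sat (M, override_on \<mu> \<kappa> X) \<phi> \<longleftrightarrow> sat (M, override_on \<nu> \<kappa> X) \<phi>" for \<kappa>
    by (intro Forall.IH) (simp add: override_on_def Forall.prems)
  then show ?case by simp
qed

text \<open>On X both assignments take the values of \<nu>. A free variable v outside X stays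
  outside X under \<pi>, so both assignments give it the value of \<mu> at \<pi> v.\<close>

lemma sat_override_comp:
  assumes "\<pi> ` (fv \<phi> - X) \<inter> X = {}"
  shows "sat (M, override_on \<mu> \<nu> X \<circ> override_on \<pi> id X) \<phi> \<longleftrightarrow> sat (M, override_on (\<mu> \<circ> \<pi>) \<nu> X) \<phi>"
  using assms by (intro sat_cong) (auto simp: override_on_def)

text \<open>The substitution lemma: without capture, a value chosen for a bound variable never
  replaces the value that \<mu> gives to a renamed free variable.\<close>

lemma sat_rename: "free_for \<pi> \<phi> \<Longrightarrow> sat (M, \<mu>) (rename \<phi> \<pi>) \<longleftrightarrow> sat (M, \<mu> \<circ> \<pi>) \<phi>"
proof (induction \<phi> arbitrary: \<pi> \<mu>)
  case (Rel p ts)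
  have "map (tm_val M \<mu>) (map (map_tm id \<pi>) ts) = map (tm_val M (\<mu> \<circ> \<pi>)) ts"
    by (simp add: tm_val_map_tm)
  then show ?case by (simp only: sat.simps rename.simps)
next
  case (Exists X \<phi>)
  then show ?case by (simp add: sat_override_comp del: comp_apply)
next
  case (Forall X \<phi>)
  then show ?case by (simp add: sat_override_comp del: comp_apply)
qed (auto simp: tm_val_map_tm o_def)

section \<open>Subsumption is a sound preorder\<close>

text \<open>Stability of a binary language passes to one component by completing a formula of it to
  a compound formula, which takes some formula of the other component.\<close>

lemma fms_nonempty: "fms L \<noteq> {}"
proof (induction L)
  case (LBigOr k L)
  have "BigOr [] \<in> fms (LBigOr k L)" by simp
  then show ?case by blast
next
  case (LBigAnd L)
  then obtain \<phi> where "\<phi> \<in> fms L" by blast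
  then have "BigAnd [\<phi>] \<in> fms (LBigAnd L)" by simp
  then show ?case by blast
qed auto

section \<open>Invariance of subsumption under renaming\<close>

text \<open>Stated for a single map instead of all permutations of a set: below a quantifier over X
  the map becomes \<open>override_on \<rho> id X\<close>, which need not be a permutation even if
  \<rho> is one.\<close>

definition stable :: "('v \<Rightarrow> 'v) \<Rightarrow> ('f, 'p, 'v) lang \<Rightarrow> bool" where
  "stable \<rho> L \<longleftrightarrow> (\<forall>\<phi>\<in>fms L. free_for \<rho> \<phi> \<and> rename \<phi> \<rho> \<in> fms L)"

lemma stable_LOrD:
  assumes "stable \<rho> (LOr L1 L2)"
  shows "stable \<rho> L1" "stable \<rho> L2"
proof -
  have *: "free_for \<rho> (Or \<phi> \<psi>) \<and> rename (Or \<phi> \<psi>) \<rho> \<in> fms (LOr L1 L2)"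
    if "\<phi> \<in> fms L1" "\<psi> \<in> fms L2" for \<phi> \<psi>
    using assms that unfolding stable_def by (metis (mono_tags, lifting) fms.simps(2) mem_Collect_eq)
  obtain \<phi>0 \<psi>0 where "\<phi>0 \<in> fms L1" "\<psi>0 \<in> fms L2" using fms_nonempty by blast
  with * show "stable \<rho> L1" "stable \<rho> L2" unfolding stable_def by auto
qed

lemma stable_LAndD:
  assumes "stable \<rho> (LAnd L1 L2)"
  shows "stable \<rho> L1" "stable \<rho> L2"
proof -
  have *: "free_for \<rho> (And \<phi> \<psi>) \<and> rename (And \<phi> \<psi>) \<rho> \<in> fms (LAnd L1 L2)"
    if "\<phi> \<in> fms L1" "\<psi> \<in> fms L2" for \<phi> \<psi>
    using assms that unfolding stable_def by (metis (mono_tags, lifting) fms.simps(3) mem_Collect_eq)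
  obtain \<phi>0 \<psi>0 where "\<phi>0 \<in> fms L1" "\<psi>0 \<in> fms L2" using fms_nonempty by blast
  with * show "stable \<rho> L1" "stable \<rho> L2" unfolding stable_def by auto
qed

lemma stable_LBigAndD: "stable \<rho> (LBigAnd L) \<Longrightarrow> stable \<rho> L"
  unfolding stable_def
proof
  fix \<phi>
  assume *: "\<forall>\<phi>\<in>fms (LBigAnd L). free_for \<rho> \<phi> \<and> rename \<phi> \<rho> \<in> fms (LBigAnd L)" and "\<phi> \<in> fms L"
  then have "BigAnd [\<phi>] \<in> fms (LBigAnd L)" by simp
  with * have "free_for \<rho> (BigAnd [\<phi>]) \<and> rename (BigAnd [\<phi>]) \<rho> \<in> fms (LBigAnd L)" by blast
  then show "free_for \<rho> \<phi> \<and> rename \<phi> \<rho> \<in> fms L" by simp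
qed

text \<open>With k = 0 the language contains only the empty disjunction, whose stability says
  nothing about \<open>L\<close>.\<close>

lemma stable_LBigOrD: "stable \<rho> (LBigOr k L) \<Longrightarrow> k > 0 \<Longrightarrow> stable \<rho> L"
  unfolding stable_def
proof
  fix \<phi>
  assume *: "\<forall>\<phi>\<in>fms (LBigOr k L). free_for \<rho> \<phi> \<and> rename \<phi> \<rho> \<in> fms (LBigOr k L)" "k > 0"
    and "\<phi> \<in> fms L"
  then have "BigOr [\<phi>] \<in> fms (LBigOr k L)" by simp
  with * have "free_for \<rho> (BigOr [\<phi>]) \<and> rename (BigOr [\<phi>]) \<rho> \<in> fms (LBigOr k L)" by blast
  then show "free_for \<rho> \<phi> \<and> rename \<phi> \<rho> \<in> fms L" by simp
qed

lemma stable_quantifierD: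
  assumes "stable \<rho> L'" "\<And>\<phi>. \<phi> \<in> fms L \<Longrightarrow> Q \<phi> \<in> fms L'"
    and "\<And>\<phi>. free_for \<rho> (Q \<phi>) \<Longrightarrow> free_for (override_on \<rho> id X) \<phi>"
    and "\<And>\<phi>. rename (Q \<phi>) \<rho> \<in> fms L' \<Longrightarrow> rename \<phi> (override_on \<rho> id X) \<in> fms L"
  shows "stable (override_on \<rho> id X) L"
  using assms unfolding stable_def by blast

lemma stable_LExD: "stable \<rho> (LEx X L) \<Longrightarrow> stable (override_on \<rho> id X) L"
  by (erule stable_quantifierD[where Q = "Exists X"]) auto

lemma stable_LAllD: "stable \<rho> (LAll X L) \<Longrightarrow> stable (override_on \<rho> id X) L"
  by (erule stable_quantifierD[where Q = "Forall X"]) auto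

lemma stable_LExAllD: "stable \<rho> (LExAll X L) \<Longrightarrow> stable (override_on \<rho> id X) L"
  by (erule stable_quantifierD[where Q = "Exists X"]) auto

lemma stable_permutes: "perm_closed X (fms L) \<Longrightarrow> finite X \<Longrightarrow> \<pi> permutes X \<Longrightarrow> stable \<pi> L"
  by (auto simp: stable_def perm_closed_def)

text \<open>Without capture, \<open>\<rho>\<close> acts off \<open>X\<close> and \<open>\<pi>\<close> on \<open>X\<close>, so the two renamings commute.\<close>

lemma rename_commute:
  assumes "\<pi> permutes X" "\<rho> ` (fv \<psi> - X) \<inter> X = {}"
    and "free_for \<pi> \<psi>" "free_for (override_on \<rho> id X) \<psi>"
  shows "rename (rename \<psi> \<pi>) (override_on \<rho> id X) = rename (rename \<psi> (override_on \<rho> id X)) \<pi>"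
proof -
  have "rename \<psi> (override_on \<rho> id X \<circ> \<pi>) = rename \<psi> (\<pi> \<circ> override_on \<rho> id X)"
  proof (rule rename_cong)
    fix v assume v: "v \<in> fv \<psi>"
    show "(override_on \<rho> id X \<circ> \<pi>) v = (\<pi> \<circ> override_on \<rho> id X) v"
    proof (cases "v \<in> X")
      case True
      then show ?thesis using permutes_in_image[OF assms(1), of v] by simp
    next
      case False
      then have "\<rho> v \<notin> X" using v assms(2) by auto
      then show ?thesis using False permutes_not_in[OF assms(1)] by simp
    qed
  qed
  then show ?thesis using assms(3,4) by (simp add: rename_rename)
qed

text \<open>The given permutation \<pi> serves again as the witness: after renaming both sides,
  \<open>rename_commute\<close> pulls the masked \<rho> past it.\<close>

lemma subsumes_rename_body:
  assumes IH: "\<And>\<phi> \<psi>. \<phi> \<in> fms L \<Longrightarrow> \<psi> \<in> fms L \<Longrightarrow> subsumes L \<phi> \<psi> \<Longrightarrow>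
      subsumes L (rename \<phi> (override_on \<rho> id X)) (rename \<psi> (override_on \<rho> id X))"
    and pc: "perm_closed X (fms L)" "finite X" and \<pi>: "\<pi> permutes X"
    and mem: "\<phi> \<in> fms L" "\<psi> \<in> fms L" and sub: "subsumes L \<phi> (rename \<psi> \<pi>)"
    and ff: "\<rho> ` (fv \<psi> - X) \<inter> X = {}" "free_for (override_on \<rho> id X) \<psi>"
  shows "\<exists>\<pi>. \<pi> permutes X \<and>
      subsumes L (rename \<phi> (override_on \<rho> id X)) (rename (rename \<psi> (override_on \<rho> id X)) \<pi>)"
proof -
  have "free_for \<pi> \<psi>" "rename \<psi> \<pi> \<in> fms L"
    using stable_permutes[OF pc \<pi>] mem by (auto simp: stable_def)
  then show ?thesis
    using IH[OF mem(1) _ sub] rename_commute[OF \<pi> ff(1) _ ff(2)] \<pi> by auto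
qed

text \<open>This is what allows permutations to be composed in transitivity and moved to the other
  side of a subsumption by their inverse. The map \<rho> varies in the induction because it is
  masked on X below a quantifier over X.\<close>

lemma subsumes_rename:
  assumes "bounded_language Sg V L" "stable \<rho> L" "\<phi> \<in> fms L" "\<psi> \<in> fms L" "subsumes L \<phi> \<psi>"
  shows "subsumes L (rename \<phi> \<rho>) (rename \<psi> \<rho>)"
  using assms
proof (induction L arbitrary: \<rho> \<phi> \<psi>)
  case (LBase A)
  then show ?case by auto
next
  case (LOr L1 L2)
  then show ?case using stable_LOrD[OF LOr.prems(2)] by auto
next
  case (LAnd L1 L2)
  then show ?case using stable_LAndD[OF LAnd.prems(2)] by auto
next
  case (LBigOr k L)
  then obtain \<phi>s \<psi>s m where *: "\<phi> = BigOr \<phi>s" "\<psi> = BigOr \<psi>s" "inj_on m {..<length \<phi>s}"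
    "\<forall>i<length \<phi>s. m i < length \<psi>s \<and> subsumes L (\<phi>s ! i) (\<psi>s ! m i)"
    "set \<phi>s \<subseteq> fms L" "set \<psi>s \<subseteq> fms L" "length \<phi>s \<le> k"
    by auto
  \<comment> \<open>The existence of an index i < \<open>length \<phi>s\<close> \<le> k gives the k
    > 0 that \<open>stable_LBigOrD\<close> asks for.\<close>
  have "subsumes L (rename (\<phi>s ! i) \<rho>) (rename (\<psi>s ! m i) \<rho>)" if "i < length \<phi>s" for i
    using that * LBigOr.prems(1) stable_LBigOrD[OF LBigOr.prems(2)]
    by (intro LBigOr.IH) (auto intro: nth_mem)
  with * show ?case by (auto intro!: exI[of _ m])
next
  case (LBigAnd L)
  then obtain \<phi>s \<psi>s m where *: "\<phi> = BigAnd \<phi>s" "\<psi> = BigAnd \<psi>s"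
    "\<forall>i<length \<psi>s. m i < length \<phi>s \<and> subsumes L (\<phi>s ! m i) (\<psi>s ! i)"
    "set \<phi>s \<subseteq> fms L" "set \<psi>s \<subseteq> fms L"
    by auto
  have "subsumes L (rename (\<phi>s ! m i) \<rho>) (rename (\<psi>s ! i) \<rho>)" if "i < length \<psi>s" for i
    using that * LBigAnd.prems(1) stable_LBigAndD[OF LBigAnd.prems(2)]
    by (intro LBigAnd.IH) (auto intro: nth_mem)
  with * show ?case by (auto intro!: exI[of _ m])
next
  case (LEx X L)
  note st = stable_LExD[OF LEx.prems(2)]
  obtain \<phi>' \<psi>' \<pi> where *: "\<phi> = Exists X \<phi>'" "\<psi> = Exists X \<psi>'" "\<pi> permutes X"
    "subsumes L \<phi>' (rename \<psi>' \<pi>)" "\<phi>' \<in> fms L" "\<psi>' \<in> fms L"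
    using LEx.prems by auto
  have "free_for \<rho> \<psi>" using LEx.prems(2,4) by (auto simp: stable_def)
  then show ?case
    using subsumes_rename_body[OF _ _ _ *(3,5,6,4), of \<rho>] LEx.IH[OF _ st] LEx.prems(1) *(1,2) by simp
next
  case (LAll X L)
  note st = stable_LAllD[OF LAll.prems(2)]
  obtain \<phi>' \<psi>' \<pi> where *: "\<phi> = Forall X \<phi>'" "\<psi> = Forall X \<psi>'" "\<pi> permutes X"
    "subsumes L \<phi>' (rename \<psi>' \<pi>)" "\<phi>' \<in> fms L" "\<psi>' \<in> fms L"
    using LAll.prems by auto
  have "free_for \<rho> \<psi>" using LAll.prems(2,4) by (auto simp: stable_def)
  then show ?case
    using subsumes_rename_body[OF _ _ _ *(3,5,6,4), of \<rho>] LAll.IH[OF _ st] LAll.prems(1) *(1,2) by simp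
next
  case (LExAll X L)
  note st = stable_LExAllD[OF LExAll.prems(2)]
  obtain \<phi>' \<psi>' \<pi> where *: "\<phi> = Exists X \<phi>' \<and> \<psi> = Exists X \<psi>' \<or> \<phi> = Forall X \<phi>' \<and> \<psi> = Forall X \<psi>' \<or>
      \<phi> = Forall X \<phi>' \<and> \<psi> = Exists X \<psi>'" "\<pi> permutes X" "subsumes L \<phi>' (rename \<psi>' \<pi>)"
    "\<phi>' \<in> fms L" "\<psi>' \<in> fms L"
    using LExAll.prems(3-5) by auto
  have ff: "free_for \<rho> \<psi>" using LExAll.prems(2,4) by (auto simp: stable_def)
  then have "\<rho> ` (fv \<psi>' - X) \<inter> X = {}" "free_for (override_on \<rho> id X) \<psi>'"
    using *(1) by (elim disjE; simp)+
  then have "\<exists>\<pi>. \<pi> permutes X \<and>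
      subsumes L (rename \<phi>' (override_on \<rho> id X)) (rename (rename \<psi>' (override_on \<rho> id X)) \<pi>)"
    using subsumes_rename_body[OF _ _ _ *(2,4,5,3), of \<rho>] LExAll.IH[OF _ st] LExAll.prems(1) by simp
  with *(1) show ?case by auto
qed

section \<open>Reflexivity and transitivity\<close>

lemma subsumes_refl: "\<phi> \<in> fms L \<Longrightarrow> subsumes L \<phi> \<phi>"
proof (induction L arbitrary: \<phi>)
  case (LBigOr k L)
  then show ?case by (force intro!: exI[of _ id] LBigOr.IH)
next
  case (LBigAnd L)
  then show ?case by (force intro!: exI[of _ id] LBigAnd.IH)
next
  case (LEx X L)
  then obtain \<psi> where "\<phi> = Exists X \<psi>" "subsumes L \<psi> \<psi>" by auto
  then show ?case using permutes_id[of X] by (auto intro!: exI[of _ id])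
next
  case (LAll X L)
  then obtain \<psi> where "\<phi> = Forall X \<psi>" "subsumes L \<psi> \<psi>" by auto
  then show ?case using permutes_id[of X] by (auto intro!: exI[of _ id])
next
  case (LExAll X L)
  then obtain \<psi> where "\<phi> = Exists X \<psi> \<or> \<phi> = Forall X \<psi>" "subsumes L \<psi> \<psi>" by auto
  then show ?case using permutes_id[of X] by (auto intro!: exI[of _ id])
qed auto

text \<open>Renaming the second subsumption by \<pi> lets it follow the first: \<phi> is below
  \<psi>\<pi>, which is below (\<chi>\<sigma>)\<pi>, and the latter is the renaming of \<chi> by
  \<pi> \<circ> \<sigma>.\<close>

lemma subsumes_trans_body:
  assumes L: "bounded_language Sg V L" "perm_closed X (fms L)" "finite X"
    and IH: "\<And>\<phi> \<psi> \<chi>. \<phi> \<in> fms L \<Longrightarrow> \<psi> \<in> fms L \<Longrightarrow> \<chi> \<in> fms L \<Longrightarrow>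
      subsumes L \<phi> \<psi> \<Longrightarrow> subsumes L \<psi> \<chi> \<Longrightarrow> subsumes L \<phi> \<chi>"
    and mem: "\<phi> \<in> fms L" "\<psi> \<in> fms L" "\<chi> \<in> fms L"
    and \<pi>: "\<pi> permutes X" "subsumes L \<phi> (rename \<psi> \<pi>)"
    and \<sigma>: "\<sigma> permutes X" "subsumes L \<psi> (rename \<chi> \<sigma>)"
  shows "\<exists>\<pi>. \<pi> permutes X \<and> subsumes L \<phi> (rename \<chi> \<pi>)"
proof -
  note st = stable_permutes[OF L(2,3)]
  have s: "free_for \<sigma> \<chi>" "rename \<chi> \<sigma> \<in> fms L" "rename \<psi> \<pi> \<in> fms L"
    "rename (rename \<chi> \<sigma>) \<pi> \<in> fms L"
    using st[OF \<pi>(1)] st[OF \<sigma>(1)] mem by (auto simp: stable_def)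
  then have "subsumes L (rename \<psi> \<pi>) (rename (rename \<chi> \<sigma>) \<pi>)"
    using subsumes_rename[OF L(1) st[OF \<pi>(1)]] mem \<sigma>(2) by blast
  then have "subsumes L \<phi> (rename \<chi> (\<pi> \<circ> \<sigma>))"
    using IH[OF _ s(3,4) \<pi>(2)] mem s(1) by (simp add: rename_rename)
  then show ?thesis using permutes_compose[OF \<sigma>(1) \<pi>(1)] by blast
qed

lemma subsumes_trans:
  assumes "bounded_language Sg V L" "\<phi> \<in> fms L" "\<psi> \<in> fms L" "\<chi> \<in> fms L"
    and "subsumes L \<phi> \<psi>" "subsumes L \<psi> \<chi>"
  shows "subsumes L \<phi> \<chi>"
  using assms
proof (induction L arbitrary: \<phi> \<psi> \<chi>)
  case (LBase A)
  then show ?case by auto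
next
  case (LOr L1 L2)
  obtain \<phi>1 \<phi>2 \<psi>1 \<psi>2 where 1: "\<phi> = Or \<phi>1 \<phi>2" "\<psi> = Or \<psi>1 \<psi>2"
    "subsumes L1 \<phi>1 \<psi>1" "subsumes L2 \<phi>2 \<psi>2"
    using LOr.prems(5) by auto
  obtain \<chi>1 \<chi>2 where 2: "\<chi> = Or \<chi>1 \<chi>2" "subsumes L1 \<psi>1 \<chi>1" "subsumes L2 \<psi>2 \<chi>2"
    using LOr.prems(6) 1(2) by auto
  have "subsumes L1 \<phi>1 \<chi>1" "subsumes L2 \<phi>2 \<chi>2"
    using LOr.prems(1-4) 1 2 LOr.IH(1)[of \<phi>1 \<psi>1 \<chi>1] LOr.IH(2)[of \<phi>2 \<psi>2 \<chi>2] by simp_all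
  then show ?case using 1(1) 2(1) by simp
next
  case (LAnd L1 L2)
  obtain \<phi>1 \<phi>2 \<psi>1 \<psi>2 where 1: "\<phi> = And \<phi>1 \<phi>2" "\<psi> = And \<psi>1 \<psi>2"
    "subsumes L1 \<phi>1 \<psi>1" "subsumes L2 \<phi>2 \<psi>2"
    using LAnd.prems(5) by auto
  obtain \<chi>1 \<chi>2 where 2: "\<chi> = And \<chi>1 \<chi>2" "subsumes L1 \<psi>1 \<chi>1" "subsumes L2 \<psi>2 \<chi>2"
    using LAnd.prems(6) 1(2) by auto
  have "subsumes L1 \<phi>1 \<chi>1" "subsumes L2 \<phi>2 \<chi>2"
    using LAnd.prems(1-4) 1 2 LAnd.IH(1)[of \<phi>1 \<psi>1 \<chi>1] LAnd.IH(2)[of \<phi>2 \<psi>2 \<chi>2] by simp_all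
  then show ?case using 1(1) 2(1) by simp
next
  case (LBigOr k L)
  then obtain \<phi>s \<psi>s m where 1: "\<phi> = BigOr \<phi>s" "\<psi> = BigOr \<psi>s" "inj_on m {..<length \<phi>s}"
    "\<forall>i<length \<phi>s. m i < length \<psi>s \<and> subsumes L (\<phi>s ! i) (\<psi>s ! m i)"
    "set \<phi>s \<subseteq> fms L" "set \<psi>s \<subseteq> fms L"
    by auto
  with LBigOr.prems obtain \<chi>s n where 2: "\<chi> = BigOr \<chi>s" "inj_on n {..<length \<psi>s}"
    "\<forall>i<length \<psi>s. n i < length \<chi>s \<and> subsumes L (\<psi>s ! i) (\<chi>s ! n i)" "set \<chi>s \<subseteq> fms L"
    by auto
  have "inj_on (n \<circ> m) {..<length \<phi>s}"
    using 1(4) by (intro comp_inj_on 1(3) inj_on_subset[OF 2(2)]) auto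
  moreover have "n (m i) < length \<chi>s \<and> subsumes L (\<phi>s ! i) (\<chi>s ! n (m i))" if "i < length \<phi>s" for i
    using that 1 2 LBigOr.prems(1) LBigOr.IH[of "\<phi>s ! i" "\<psi>s ! m i" "\<chi>s ! n (m i)"]
    by (auto simp: subset_eq)
  ultimately show ?case using 1 2 by (auto intro!: exI[of _ "n \<circ> m"])
next
  case (LBigAnd L)
  then obtain \<phi>s \<psi>s m where 1: "\<phi> = BigAnd \<phi>s" "\<psi> = BigAnd \<psi>s"
    "\<forall>i<length \<psi>s. m i < length \<phi>s \<and> subsumes L (\<phi>s ! m i) (\<psi>s ! i)"
    "set \<phi>s \<subseteq> fms L" "set \<psi>s \<subseteq> fms L"
    by auto
  with LBigAnd.prems obtain \<chi>s n where 2: "\<chi> = BigAnd \<chi>s"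
    "\<forall>i<length \<chi>s. n i < length \<psi>s \<and> subsumes L (\<psi>s ! n i) (\<chi>s ! i)" "set \<chi>s \<subseteq> fms L"
    by auto
  have "m (n i) < length \<phi>s \<and> subsumes L (\<phi>s ! m (n i)) (\<chi>s ! i)" if "i < length \<chi>s" for i
    using that 1 2 LBigAnd.prems(1) LBigAnd.IH[of "\<phi>s ! m (n i)" "\<psi>s ! n i" "\<chi>s ! i"]
    by (auto simp: subset_eq)
  then show ?case using 1 2 by (auto intro!: exI[of _ "m \<circ> n"])
next
  case (LEx X L)
  then have L: "bounded_language Sg V L" "perm_closed X (fms L)" "finite X" by auto
  obtain \<phi>' \<psi>' \<pi> where 1: "\<phi> = Exists X \<phi>'" "\<psi> = Exists X \<psi>'" "\<pi> permutes X"
    "subsumes L \<phi>' (rename \<psi>' \<pi>)" "\<phi>' \<in> fms L" "\<psi>' \<in> fms L"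
    using LEx.prems(2-5) by auto
  then obtain \<chi>' \<sigma> where 2: "\<chi> = Exists X \<chi>'" "\<sigma> permutes X" "subsumes L \<psi>' (rename \<chi>' \<sigma>)"
    "\<chi>' \<in> fms L"
    using LEx.prems(3,4,6) by auto
  have "\<exists>\<pi>. \<pi> permutes X \<and> subsumes L \<phi>' (rename \<chi>' \<pi>)"
    using subsumes_trans_body[OF L LEx.IH[OF L(1)] 1(5,6) 2(4) 1(3,4) 2(2,3)] .
  with 1(1) 2(1) show ?case by auto
next
  case (LAll X L)
  then have L: "bounded_language Sg V L" "perm_closed X (fms L)" "finite X" by auto
  obtain \<phi>' \<psi>' \<pi> where 1: "\<phi> = Forall X \<phi>'" "\<psi> = Forall X \<psi>'" "\<pi> permutes X"
    "subsumes L \<phi>' (rename \<psi>' \<pi>)" "\<phi>' \<in> fms L" "\<psi>' \<in> fms L"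
    using LAll.prems(2-5) by auto
  then obtain \<chi>' \<sigma> where 2: "\<chi> = Forall X \<chi>'" "\<sigma> permutes X" "subsumes L \<psi>' (rename \<chi>' \<sigma>)"
    "\<chi>' \<in> fms L"
    using LAll.prems(3,4,6) by auto
  have "\<exists>\<pi>. \<pi> permutes X \<and> subsumes L \<phi>' (rename \<chi>' \<pi>)"
    using subsumes_trans_body[OF L LAll.IH[OF L(1)] 1(5,6) 2(4) 1(3,4) 2(2,3)] .
  with 1(1) 2(1) show ?case by auto
next
  case (LExAll X L)
  then have L: "bounded_language Sg V L" "perm_closed X (fms L)" "finite X" by auto
  obtain \<phi>' \<psi>' \<pi> where 1: "\<phi> = Exists X \<phi>' \<and> \<psi> = Exists X \<psi>' \<or> \<phi> = Forall X \<phi>' \<and> \<psi> = Forall X \<psi>' \<or>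
      \<phi> = Forall X \<phi>' \<and> \<psi> = Exists X \<psi>'" "\<pi> permutes X" "subsumes L \<phi>' (rename \<psi>' \<pi>)"
    "\<phi>' \<in> fms L" "\<psi>' \<in> fms L"
    using LExAll.prems(2-5) by auto
  then obtain \<chi>' \<sigma> where 2: "\<psi> = Exists X \<psi>' \<and> \<chi> = Exists X \<chi>' \<or> \<psi> = Forall X \<psi>' \<and> \<chi> = Forall X \<chi>' \<or>
      \<psi> = Forall X \<psi>' \<and> \<chi> = Exists X \<chi>'" "\<sigma> permutes X" "subsumes L \<psi>' (rename \<chi>' \<sigma>)"
    "\<chi>' \<in> fms L"
    using LExAll.prems(3,4,6) by auto
  have "\<exists>\<pi>. \<pi> permutes X \<and> subsumes L \<phi>' (rename \<chi>' \<pi>)"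
    using subsumes_trans_body[OF L LExAll.IH[OF L(1)] 1(4,5) 2(4) 1(2,3) 2(2,3)] .
  with 1(1) 2(1) show ?case by auto
qed

section \<open>Soundness of subsumption\<close>

lemma override_on_comp_permutes:
  "\<pi> permutes X \<Longrightarrow> override_on \<mu> \<nu> X \<circ> \<pi> = override_on \<mu> (\<nu> \<circ> \<pi>) X"
  by (auto simp: override_on_def permutes_in_image permutes_not_in fun_eq_iff)

text \<open>Permuting the bound variables in the formula amounts to permuting the values chosen for
  them.\<close>

lemma sat_subsumes_body:
  assumes "perm_closed X (fms L)" "finite X" "\<pi> permutes X" "\<psi> \<in> fms L"
    and "sat (M, override_on \<mu> \<nu> X) (rename \<psi> \<pi>)"
  shows "sat (M, override_on \<mu> (\<nu> \<circ> \<pi>) X) \<psi>"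
proof -
  have "free_for \<pi> \<psi>" using stable_permutes[OF assms(1-3)] assms(4) by (auto simp: stable_def)
  then show ?thesis
    using assms(5) by (simp add: sat_rename override_on_comp_permutes[OF assms(3)])
qed

lemma subsumes_sound:
  assumes "bounded_language Sg V L" "univ M \<noteq> {}" "\<phi> \<in> fms L" "\<psi> \<in> fms L"
    and "subsumes L \<phi> \<psi>" "sat (M, \<mu>) \<phi>"
  shows "sat (M, \<mu>) \<psi>"
  using assms
proof (induction L arbitrary: \<mu> \<phi> \<psi>)
  case (LBase A)
  then show ?case by auto
next
  case (LOr L1 L2)
  then show ?case by auto
next
  case (LAnd L1 L2)
  then show ?case by auto
next
  case (LBigOr k L)
  then obtain \<phi>s \<psi>s m where *: "\<phi> = BigOr \<phi>s" "\<psi> = BigOr \<psi>s"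
    "\<forall>i<length \<phi>s. m i < length \<psi>s \<and> subsumes L (\<phi>s ! i) (\<psi>s ! m i)"
    "set \<phi>s \<subseteq> fms L" "set \<psi>s \<subseteq> fms L"
    by auto
  then obtain i where i: "i < length \<phi>s" "sat (M, \<mu>) (\<phi>s ! i)"
    using LBigOr.prems(6) by (auto simp: in_set_conv_nth)
  then have "sat (M, \<mu>) (\<psi>s ! m i)"
    using * LBigOr.prems(1,2) by (intro LBigOr.IH[of "\<phi>s ! i" "\<psi>s ! m i"]) (auto simp: subset_eq)
  then show ?case using * i by auto
next
  case (LBigAnd L)
  then obtain \<phi>s \<psi>s m where *: "\<phi> = BigAnd \<phi>s" "\<psi> = BigAnd \<psi>s"
    "\<forall>i<length \<psi>s. m i < length \<phi>s \<and> subsumes L (\<phi>s ! m i) (\<psi>s ! i)"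
    "set \<phi>s \<subseteq> fms L" "set \<psi>s \<subseteq> fms L"
    by auto
  have "sat (M, \<mu>) (\<psi>s ! i)" if "i < length \<psi>s" for i
    using * that LBigAnd.prems(1,2,6)
    by (intro LBigAnd.IH[of "\<phi>s ! m i" "\<psi>s ! i"]) (auto simp: subset_eq)
  then show ?case using * by (auto simp: in_set_conv_nth)
next
  case (LEx X L)
  then have L: "bounded_language Sg V L" "perm_closed X (fms L)" "finite X" by auto
  obtain \<phi>' \<psi>' \<pi> where *: "\<phi> = Exists X \<phi>'" "\<psi> = Exists X \<psi>'" "\<pi> permutes X"
    "subsumes L \<phi>' (rename \<psi>' \<pi>)" "\<phi>' \<in> fms L" "\<psi>' \<in> fms L"
    using LEx.prems by auto
  have "rename \<psi>' \<pi> \<in> fms L" using stable_permutes[OF L(2,3) *(3)] *(6) by (auto simp: stable_def)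
  note IH = LEx.IH[OF L(1) LEx.prems(2) *(5) this *(4)]
  obtain \<nu> where \<nu>: "\<forall>v\<in>X. \<nu> v \<in> univ M" "sat (M, override_on \<mu> \<nu> X) \<phi>'"
    using LEx.prems(6) *(1) by auto
  have "\<forall>v\<in>X. (\<nu> \<circ> \<pi>) v \<in> univ M" using \<nu>(1) permutes_in_image[OF *(3)] by auto
  then show ?case
    using sat_subsumes_body[OF L(2,3) *(3,6) IH[OF \<nu>(2)]] *(2) by (auto intro!: exI[of _ "\<nu> \<circ> \<pi>"])
next
  case (LAll X L)
  then have L: "bounded_language Sg V L" "perm_closed X (fms L)" "finite X" by auto
  obtain \<phi>' \<psi>' \<pi> where *: "\<phi> = Forall X \<phi>'" "\<psi> = Forall X \<psi>'" "\<pi> permutes X"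
    "subsumes L \<phi>' (rename \<psi>' \<pi>)" "\<phi>' \<in> fms L" "\<psi>' \<in> fms L"
    using LAll.prems by auto
  have "rename \<psi>' \<pi> \<in> fms L" using stable_permutes[OF L(2,3) *(3)] *(6) by (auto simp: stable_def)
  note IH = LAll.IH[OF L(1) LAll.prems(2) *(5) this *(4)]
  have "sat (M, override_on \<mu> \<nu> X) \<psi>'" if \<nu>: "\<forall>v\<in>X. \<nu> v \<in> univ M" for \<nu>
  proof -
    \<comment> \<open>The hypothesis is instantiated at \<nu> \<circ> \<open>inv \<pi>\<close>
      because \<open>sat_subsumes_body\<close> composes the chosen values with \<pi>, which then
      gives back \<nu>.\<close>
    have "\<forall>v\<in>X. (\<nu> \<circ> inv \<pi>) v \<in> univ M"
      using \<nu> permutes_in_image[OF permutes_inv[OF *(3)]] by auto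
    then have "sat (M, override_on \<mu> (\<nu> \<circ> inv \<pi>) X) \<phi>'" using LAll.prems(6) *(1) by auto
    from sat_subsumes_body[OF L(2,3) *(3,6) IH[OF this]]
    show ?thesis using permutes_inv_o(2)[OF *(3)] by (simp add: comp_assoc)
  qed
  then show ?case using *(2) by auto
next
  case (LExAll X L)
  then have L: "bounded_language Sg V L" "perm_closed X (fms L)" "finite X" by auto
  obtain \<phi>' \<psi>' \<pi> where *: "\<phi> = Exists X \<phi>' \<and> \<psi> = Exists X \<psi>' \<or> \<phi> = Forall X \<phi>' \<and> \<psi> = Forall X \<psi>' \<or>
      \<phi> = Forall X \<phi>' \<and> \<psi> = Exists X \<psi>'" "\<pi> permutes X"
    "subsumes L \<phi>' (rename \<psi>' \<pi>)" "\<phi>' \<in> fms L" "\<psi>' \<in> fms L"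
    using LExAll.prems(3-5) by auto
  have "rename \<psi>' \<pi> \<in> fms L" using stable_permutes[OF L(2,3) *(2)] *(5) by (auto simp: stable_def)
  note IH = LExAll.IH[OF L(1) LExAll.prems(2) *(4) this *(3)]
  have body: "sat (M, override_on \<mu> \<nu> X) \<psi>'" if "sat (M, override_on \<mu> (\<nu> \<circ> inv \<pi>) X) \<phi>'" for \<nu>
    using sat_subsumes_body[OF L(2,3) *(2,5) IH[OF that]] permutes_inv_o(2)[OF *(2)]
    by (simp add: comp_assoc)
  have dom: "\<forall>v\<in>X. (\<nu> \<circ> inv \<pi>) v \<in> univ M" if "\<forall>v\<in>X. \<nu> v \<in> univ M" for \<nu>
    using that permutes_in_image[OF permutes_inv[OF *(2)]] by auto
  have 1: "\<exists>\<nu>. (\<forall>v\<in>X. \<nu> v \<in> univ M) \<and> sat (M, override_on \<mu> \<nu> X) \<psi>'"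
    if ex: "sat (M, \<mu>) (Exists X \<phi>')"
  proof -
    obtain \<nu> where \<nu>: "\<forall>v\<in>X. \<nu> v \<in> univ M" "sat (M, override_on \<mu> \<nu> X) \<phi>'"
      using ex by auto
    have "\<forall>v\<in>X. (\<nu> \<circ> \<pi>) v \<in> univ M" using \<nu>(1) permutes_in_image[OF *(2)] by auto
    then show ?thesis using sat_subsumes_body[OF L(2,3) *(2,5) IH[OF \<nu>(2)]] by blast
  qed
  have 2: "sat (M, \<mu>) (Forall X \<psi>')" if "sat (M, \<mu>) (Forall X \<phi>')"
    using that body dom by auto
  from \<open>univ M \<noteq> {}\<close> obtain u where "u \<in> univ M" by blast
  \<comment> \<open>For a universal formula below an existential one, any assignment of X into the
    universe is a witness; this is where the universe has to be nonempty.\<close>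
  then have "sat (M, \<mu>) (Exists X \<psi>')" if "sat (M, \<mu>) (Forall X \<psi>')"
    using that by (auto intro!: exI[of _ "\<lambda>_. u"])
  with 1 2 *(1) LExAll.prems(6) show ?case by auto
qed

section \<open>Linear orders relative to a set\<close>

text \<open>The carrier is explicit because \<open>lang_le\<close> is defined on all formulas but
  need not be linear beyond the canonical ones.\<close>

definition linear_on :: "'a set \<Rightarrow> ('a \<Rightarrow> 'a \<Rightarrow> bool) \<Rightarrow> bool" where
  "linear_on S le \<longleftrightarrow>
     (\<forall>x\<in>S. \<forall>y\<in>S. le x y \<or> le y x) \<and>
     (\<forall>x\<in>S. \<forall>y\<in>S. le x y \<longrightarrow> le y x \<longrightarrow> x = y) \<and>
     (\<forall>x\<in>S. \<forall>y\<in>S. \<forall>z\<in>S. le x y \<longrightarrow> le y z \<longrightarrow> le x z)"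

lemma linear_on_total: "linear_on S le \<Longrightarrow> x \<in> S \<Longrightarrow> y \<in> S \<Longrightarrow> le x y \<or> le y x"
  unfolding linear_on_def by blast

lemma linear_on_antisym: "linear_on S le \<Longrightarrow> le x y \<Longrightarrow> le y x \<Longrightarrow> x \<in> S \<Longrightarrow> y \<in> S \<Longrightarrow> x = y"
  unfolding linear_on_def by blast

lemma linear_on_trans:
  "linear_on S le \<Longrightarrow> le x y \<Longrightarrow> le y z \<Longrightarrow> x \<in> S \<Longrightarrow> y \<in> S \<Longrightarrow> z \<in> S \<Longrightarrow> le x z"
  unfolding linear_on_def by blast

lemma linear_on_subset: "linear_on S le \<Longrightarrow> T \<subseteq> S \<Longrightarrow> linear_on T le"
  unfolding linear_on_def by blast

lemma linear_on_converse: "linear_on S le \<Longrightarrow> linear_on S (\<lambda>x y. le y x)"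
  unfolding linear_on_def by blast

lemma linear_on_image:
  assumes "linear_on S le" and *: "\<And>x y. x \<in> S \<Longrightarrow> y \<in> S \<Longrightarrow> le' (f x) (f y) \<longleftrightarrow> le x y"
  shows "linear_on (f ` S) le'"
  unfolding linear_on_def
proof (intro conjI ballI impI; elim imageE)
  fix a b x y assume "a = f x" "b = f y" "x \<in> S" "y \<in> S"
  then show "le' a b \<or> le' b a" using linear_on_total[OF assms(1)] by (simp add: *)
next
  fix a b x y assume "le' a b" "le' b a" "a = f x" "b = f y" "x \<in> S" "y \<in> S"
  then show "a = b" using linear_on_antisym[OF assms(1), of x y] by (simp add: *)
next
  fix a b c x y z
  assume "le' a b" "le' b c" "a = f x" "b = f y" "c = f z" "x \<in> S" "y \<in> S" "z \<in> S"
  then show "le' a c" using linear_on_trans[OF assms(1), of x y z] by (simp add: *)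
qed

lemma linear_on_lex_prod:
  assumes "linear_on S le1" "linear_on T le2"
  shows "linear_on (S \<times> T)
    (\<lambda>p q. fst p \<noteq> fst q \<and> le1 (fst p) (fst q) \<or> fst p = fst q \<and> le2 (snd p) (snd q))"
    (is "linear_on _ ?le")
  unfolding linear_on_def
proof (intro conjI ballI impI)
  fix p q assume "p \<in> S \<times> T" "q \<in> S \<times> T"
  then show "?le p q \<or> ?le q p"
    using linear_on_total[OF assms(1), of "fst p" "fst q"]
      linear_on_total[OF assms(2), of "snd p" "snd q"] by auto
next
  fix p q assume "p \<in> S \<times> T" "q \<in> S \<times> T" "?le p q" "?le q p"
  then show "p = q"
    using linear_on_antisym[OF assms(1), of "fst p" "fst q"]
      linear_on_antisym[OF assms(2), of "snd p" "snd q"] by (auto simp: prod_eq_iff)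
next
  fix p q r assume *: "p \<in> S \<times> T" "q \<in> S \<times> T" "r \<in> S \<times> T" "?le p q" "?le q r"
  then show "?le p r"
    using linear_on_antisym[OF assms(1), of "fst p" "fst q"]
      linear_on_trans[OF assms(1), of "fst p" "fst q" "fst r"]
      linear_on_trans[OF assms(2), of "snd p" "snd q" "snd r"]
    by (cases "fst p = fst q"; cases "fst q = fst r"; auto)
qed

section \<open>Lexicographic order on lists\<close>

text \<open>Common form of both sequence orders. Disjunctions are compared by it after reversing the
  lists; conjunctions by it over the converse element order and with the two lists
  exchanged.\<close>

definition lexle :: "('a \<Rightarrow> 'a \<Rightarrow> bool) \<Rightarrow> 'a list \<Rightarrow> 'a list \<Rightarrow> bool" where
  "lexle le xs ys \<longleftrightarrow> prefix xs ys \<or> first_diff_less le xs ys"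

lemma first_diff_less_converse: "first_diff_less (\<lambda>x y. le y x) xs ys \<longleftrightarrow> first_diff_less le ys xs"
  unfolding first_diff_less_def by metis

lemma first_diff_less_Cons:
  "first_diff_less le (x # xs) (y # ys) \<longleftrightarrow> (if x = y then first_diff_less le xs ys else le x y)"
proof -
  have ex: "(\<exists>i. P i) \<longleftrightarrow> P 0 \<or> (\<exists>i. P (Suc i))" for P by (metis nat.exhaust)
  show ?thesis
    unfolding first_diff_less_def
    by (subst ex) (auto simp: All_less_Suc2)
qed

lemma lexle_Nil [simp]: "lexle le [] ys" "lexle le (x # xs) [] \<longleftrightarrow> False"
  by (simp_all add: lexle_def first_diff_less_def)

lemma lexle_Cons [simp]:
  "lexle le (x # xs) (y # ys) \<longleftrightarrow> (if x = y then lexle le xs ys else le x y)"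
  by (auto simp: lexle_def first_diff_less_Cons)

lemma linear_on_lexle:
  assumes "linear_on S le"
  shows "linear_on (lists S) (lexle le)"
  unfolding linear_on_def
proof (intro conjI ballI impI)
  fix xs ys assume "xs \<in> lists S" "ys \<in> lists S"
  then show "lexle le xs ys \<or> lexle le ys xs"
  proof (induction xs arbitrary: ys rule: list.induct)
    case (Cons x xs)
    then show ?case using linear_on_total[OF assms] by (cases ys) auto
  qed simp
next
  fix xs ys assume "xs \<in> lists S" "ys \<in> lists S" "lexle le xs ys" "lexle le ys xs"
  then show "xs = ys"
  proof (induction xs arbitrary: ys rule: list.induct)
    case Nil
    then show ?case by (cases ys) auto
  next
    case (Cons x xs)
    then show ?case using linear_on_antisym[OF assms] by (cases ys) (auto split: if_splits)
  qed
next
  fix xs ys zs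
  assume "xs \<in> lists S" "ys \<in> lists S" "zs \<in> lists S" "lexle le xs ys" "lexle le ys zs"
  then show "lexle le xs zs"
  proof (induction xs arbitrary: ys zs rule: list.induct)
    case (Cons x xs)
    from Cons.prems(4) obtain y ys' where ys: "ys = y # ys'" by (cases ys) auto
    from Cons.prems(5) ys obtain z zs' where zs: "zs = z # zs'" by (cases zs) auto
    have mem: "x \<in> S" "y \<in> S" "z \<in> S" "xs \<in> lists S" "ys' \<in> lists S" "zs' \<in> lists S"
      using Cons.prems(1-3) ys zs by auto
    have le: "if x = y then lexle le xs ys' else le x y" "if y = z then lexle le ys' zs' else le y z"
      using Cons.prems(4,5) ys zs by simp_all
    consider "x = y" "y = z" | "x = y" "y \<noteq> z" | "x \<noteq> y" "y = z" | "x \<noteq> y" "y \<noteq> z" by blast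
    then show ?case
    proof cases
      case 1
      then show ?thesis using le zs Cons.IH[OF mem(4-6)] by simp
    next
      case 4
      then have "le x y" "le y z" using le by simp_all
      then have "le x z" using linear_on_trans[OF assms] mem by blast
      moreover have "x \<noteq> z" using linear_on_antisym[OF assms \<open>le x y\<close>] \<open>le y z\<close> mem 4 by blast
      ultimately show ?thesis using zs by simp
    qed (use le zs in simp_all)
  qed simp
qed

text \<open>The first difference is decided by the pointwise hypothesis; without a difference, the
  shorter list is a prefix.\<close>

lemma lexle_pointwise:
  assumes "length xs \<le> length ys" "\<And>i. i < length xs \<Longrightarrow> le (xs ! i) (ys ! i)"
  shows "lexle le xs ys"
  using assms
proof (induction xs arbitrary: ys)
  case (Cons x xs)
  then obtain y ys' where ys: "ys = y # ys'" by (cases ys) auto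
  have "lexle le xs ys'"
  proof (rule Cons.IH)
    show "length xs \<le> length ys'" using Cons.prems(1) ys by simp
    show "le (xs ! i) (ys' ! i)" if "i < length xs" for i
      using Cons.prems(2)[of "Suc i"] that ys by simp
  qed
  then show ?case using Cons.prems(2)[of 0] ys by simp
qed simp

section \<open>Least elements and sorted lists\<close>

lemma ex_least:
  assumes "linear_on S le" "finite S" "S \<noteq> {}"
  shows "\<exists>x\<in>S. \<forall>y\<in>S. le x y"
  using assms(2,3,1)
proof (induction S rule: finite_ne_induct)
  case (singleton x)
  then show ?case using linear_on_total[OF singleton, of x x] by simp
next
  case (insert x S)
  then obtain m where m: "m \<in> S" "\<forall>y\<in>S. le m y"
    using linear_on_subset[OF insert.prems, of S] by auto
  have x: "le x x" using linear_on_total[OF insert.prems, of x x] by simp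
  show ?case
  proof (cases "le m x")
    case True
    then show ?thesis using m by auto
  next
    case False
    then have "le x m" using linear_on_total[OF insert.prems, of x m] m(1) by simp
    then have "\<forall>y\<in>S. le x y" using linear_on_trans[OF insert.prems] m by blast
    then show ?thesis using x by auto
  qed
qed

lemma least_wrt:
  assumes "linear_on S le" "finite S" "S \<noteq> {}"
  shows "least_wrt le S \<in> S" "y \<in> S \<Longrightarrow> le (least_wrt le S) y"
proof -
  obtain x where x: "x \<in> S" "\<forall>y\<in>S. le x y" using ex_least[OF assms] by blast
  then have "\<exists>!x. x \<in> S \<and> (\<forall>y\<in>S. le x y)" using linear_on_antisym[OF assms(1)] by blast
  from theI'[OF this] show "least_wrt le S \<in> S" "y \<in> S \<Longrightarrow> le (least_wrt le S) y"
    unfolding least_wrt_def by blast+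
qed

text \<open>Selection sort: a least element goes first and the remaining list is sorted by induction
  on the length.\<close>

lemma ex_sorted:
  assumes "linear_on (set xs) le"
  shows "\<exists>ys. mset ys = mset xs \<and> sorted_wrt le ys"
  using assms
proof (induction "length xs" arbitrary: xs)
  case (Suc n)
  then have "set xs \<noteq> {}" by auto
  then obtain x where x: "x \<in> set xs" "\<forall>y\<in>set xs. le x y" using ex_least[OF Suc.prems] by blast
  have "n = length (remove1 x xs)" using Suc.hyps(2) x(1) by (simp add: length_remove1)
  moreover have sub: "set (remove1 x xs) \<subseteq> set xs" by (rule set_remove1_subset)
  ultimately obtain ys where ys: "mset ys = mset (remove1 x xs)" "sorted_wrt le ys"
    using Suc.hyps(1) linear_on_subset[OF Suc.prems] by blast
  then have "set ys \<subseteq> set xs" using sub by (metis set_mset_mset)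
  then have "mset (x # ys) = mset xs" "sorted_wrt le (x # ys)" using x ys by auto
  then show ?case by blast
qed simp

text \<open>Each head occurs in the other list, so the heads bound each other and agree by
  antisymmetry; the tails follow by induction.\<close>

lemma sorted_unique:
  assumes "linear_on (set xs) le" "mset xs = mset ys" "sorted_wrt le xs" "sorted_wrt le ys"
  shows "xs = ys"
  using assms
proof (induction xs arbitrary: ys)
  case (Cons x xs)
  then obtain y ys' where ys: "ys = y # ys'" by (cases ys) auto
  have set: "set (x # xs) = set ys" using Cons.prems(2) by (metis set_mset_mset)
  have "x = y \<or> le x y" "x = y \<or> le y x" using Cons.prems(3,4) set ys by auto
  then have "x = y" using linear_on_antisym[OF Cons.prems(1), of x y] set ys by auto
  moreover have "xs = ys'"
    using Cons \<open>x = y\<close> ys by (intro Cons.IH) (auto intro: linear_on_subset)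
  ultimately show ?case using ys by simp
qed simp

lemma sort_list_wrt:
  assumes "linear_on (set xs) le"
  shows "mset (sort_list_wrt le xs) = mset xs" "sorted_wrt le (sort_list_wrt le xs)"
proof -
  have "\<exists>!ys. mset ys = mset xs \<and> sorted_wrt le ys"
    using ex_sorted[OF assms] sorted_unique assms by (metis set_mset_mset)
  from theI'[OF this]
  show "mset (sort_list_wrt le xs) = mset xs" "sorted_wrt le (sort_list_wrt le xs)"
    unfolding sort_list_wrt_def by blast+
qed

lemma sort_set_wrt:
  assumes "linear_on S le" "finite S"
  shows "set (sort_set_wrt le S) = S" "distinct (sort_set_wrt le S)"
    "sorted_wrt le (sort_set_wrt le S)"
proof -
  obtain xs where xs: "set xs = S" "distinct xs" using finite_distinct_list[OF assms(2)] by blast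
  then obtain ys where "mset ys = mset xs" "sorted_wrt le ys" using ex_sorted assms(1) by blast
  moreover from this(1) have "set ys = S" "distinct ys"
    using xs mset_eq_imp_distinct_iff mset_eq_setD by blast+
  ultimately have ys: "set ys = S" "distinct ys" "sorted_wrt le ys" by blast+
  moreover have "zs = ys" if "set zs = S" "distinct zs" "sorted_wrt le zs" for zs
    using sorted_unique[of zs le ys] assms(1) that ys set_eq_iff_mset_eq_distinct by blast
  ultimately have "\<exists>!ys. set ys = S \<and> distinct ys \<and> sorted_wrt le ys" by blast
  from theI'[OF this]
  show "set (sort_set_wrt le S) = S" "distinct (sort_set_wrt le S)"
    "sorted_wrt le (sort_set_wrt le S)"
    unfolding sort_set_wrt_def by blast+
qed

lemma linear_on_sorted_nth:
  assumes "linear_on S le" "set xs \<subseteq> S" "sorted_wrt le xs" "i \<le> j" "j < length xs"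
  shows "le (xs ! i) (xs ! j)"
proof (cases "i = j")
  case True
  moreover have "xs ! j \<in> S" using assms(2,5) nth_mem by blast
  ultimately show ?thesis using linear_on_total[OF assms(1)] by blast
next
  case False
  then show ?thesis using assms(3-5) by (simp add: sorted_wrt_iff_nth_less)
qed

section \<open>Canonicalization\<close>

text \<open>The induction hypothesis carried through the construction of a language: on canonical formulas
  \<open>lang_le\<close> is a linear order extending subsumption, so subsumption is antisymmetric there, and
  subsumption-equivalent formulas have the same canonical form.\<close>

locale canonizing_language =
  fixes Sg :: "('f, 'p) signature" and V :: "'v set"
    and ord :: "('f, 'p, 'v) fm set \<Rightarrow> ('f, 'p, 'v) fm rel" and L :: "('f, 'p, 'v) lang"
  assumes bounded: "bounded_language Sg V L"
    and finite_canonical: "finite (canon ord L ` fms L)"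
    and linear: "linear_on (canon ord L ` fms L) (lang_le ord L)"
    and canon_in: "\<phi> \<in> fms L \<Longrightarrow> canon ord L \<phi> \<in> fms L"
    and canon_subsumes: "\<phi> \<in> fms L \<Longrightarrow> subsumes L (canon ord L \<phi>) \<phi>"
    and subsumes_canon: "\<phi> \<in> fms L \<Longrightarrow> subsumes L \<phi> (canon ord L \<phi>)"
    and subsumes_imp_le: "\<phi> \<in> canon ord L ` fms L \<Longrightarrow> \<psi> \<in> canon ord L ` fms L \<Longrightarrow>
      subsumes L \<phi> \<psi> \<Longrightarrow> lang_le ord L \<phi> \<psi>"
begin

abbreviation canonical :: "('f, 'p, 'v) fm set" where
  "canonical \<equiv> canon ord L ` fms L"

lemma canonical_in: "\<phi> \<in> canonical \<Longrightarrow> \<phi> \<in> fms L"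
  by (auto intro: canon_in)

lemma trans: "subsumes L \<phi> \<psi> \<Longrightarrow> subsumes L \<psi> \<chi> \<Longrightarrow> \<phi> \<in> fms L \<Longrightarrow> \<psi> \<in> fms L \<Longrightarrow> \<chi> \<in> fms L \<Longrightarrow>
    subsumes L \<phi> \<chi>"
  by (rule subsumes_trans[OF bounded])

lemma antisym: "\<phi> \<in> canonical \<Longrightarrow> \<psi> \<in> canonical \<Longrightarrow> subsumes L \<phi> \<psi> \<Longrightarrow> subsumes L \<psi> \<phi> \<Longrightarrow> \<phi> = \<psi>"
  by (rule linear_on_antisym[OF linear]) (simp_all add: subsumes_imp_le)

lemma canon_mono:
  assumes "\<phi> \<in> fms L" "\<psi> \<in> fms L" "subsumes L \<phi> \<psi>"
  shows "subsumes L (canon ord L \<phi>) (canon ord L \<psi>)"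
proof -
  have "subsumes L (canon ord L \<phi>) \<psi>"
    by (rule trans[OF canon_subsumes[OF assms(1)] assms(3) canon_in[OF assms(1)] assms(1,2)])
  from trans[OF this subsumes_canon[OF assms(2)]] show ?thesis
    by (simp add: canon_in assms(1,2))
qed

lemma canon_eq:
  assumes "\<phi> \<in> fms L" "\<psi> \<in> fms L" "subsumes L \<phi> \<psi>" "subsumes L \<psi> \<phi>"
  shows "canon ord L \<phi> = canon ord L \<psi>"
  by (rule antisym) (use assms canon_mono in auto)

text \<open>Among the finitely many elements of \<open>S\<close> below \<phi>, take the least one
  for \<open>lang_le\<close>. An element of \<open>S\<close> below it is again below \<phi>, hence
  not smaller in the order; being subsumed by it from below it is also not larger, so the two are
  equal.\<close>

lemma minimal_below:
  assumes "S \<subseteq> canonical" "\<phi> \<in> S"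
  shows "\<exists>\<psi>\<in>minimals (subsumes L) S. subsumes L \<psi> \<phi>"
proof -
  let ?T = "{\<psi>\<in>S. subsumes L \<psi> \<phi>}"
  have "\<phi> \<in> ?T" using assms subsumes_refl[OF canonical_in] by auto
  moreover have T: "linear_on ?T (lang_le ord L)" "finite ?T"
    using assms(1) finite_canonical by (auto intro: linear_on_subset[OF linear] finite_subset)
  ultimately obtain \<psi> where \<psi>: "\<psi> \<in> S" "subsumes L \<psi> \<phi>" "\<forall>\<chi>\<in>?T. lang_le ord L \<psi> \<chi>"
    using ex_least[OF T] by auto
  have "\<chi> = \<psi>" if "\<chi> \<in> S" "subsumes L \<chi> \<psi>" for \<chi>
  proof -
    have "subsumes L \<chi> \<phi>"
      by (rule trans[OF that(2) \<psi>(2)]; rule canonical_in) (use that(1) \<psi>(1) assms in auto)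
    then have "lang_le ord L \<psi> \<chi>" using \<psi>(3) that(1) by blast
    moreover have "lang_le ord L \<chi> \<psi>"
      by (rule subsumes_imp_le) (use that \<psi>(1) assms(1) in auto)
    ultimately show ?thesis
      using linear_on_antisym[OF linear, of \<chi> \<psi>] that(1) \<psi>(1) assms(1) by auto
  qed
  then show ?thesis using \<psi>(1,2) unfolding minimals_def by blast
qed

section \<open>Canonical bodies below a quantifier\<close>

text \<open>The body that \<open>canon\<close> selects in each of the three quantifier languages, so
  that they share one theory.\<close>

definition canon_body :: "'v set \<Rightarrow> ('f, 'p, 'v) fm \<Rightarrow> ('f, 'p, 'v) fm" where
  "canon_body X \<phi> = least_wrt (lang_le ord L) {canon ord L (rename \<phi> \<pi>) | \<pi>. \<pi> permutes X}"

context
  fixes X :: "'v set"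
  assumes X: "finite X" "perm_closed X (fms L)"
begin

lemma rename_in: "\<pi> permutes X \<Longrightarrow> \<phi> \<in> fms L \<Longrightarrow> rename \<phi> \<pi> \<in> fms L"
  using stable_permutes[OF X(2,1)] unfolding stable_def by blast

lemma rename_comp: "\<pi> permutes X \<Longrightarrow> \<phi> \<in> fms L \<Longrightarrow> rename (rename \<phi> \<pi>) \<rho> = rename \<phi> (\<rho> \<circ> \<pi>)"
  using stable_permutes[OF X(2,1)] rename_rename unfolding stable_def by blast

lemma rename_inv: "\<pi> permutes X \<Longrightarrow> \<phi> \<in> fms L \<Longrightarrow> rename (rename \<phi> \<pi>) (inv \<pi>) = \<phi>"
  by (simp add: rename_comp permutes_inv_o(2))

lemma rename_mono:
  "\<pi> permutes X \<Longrightarrow> \<phi> \<in> fms L \<Longrightarrow> \<psi> \<in> fms L \<Longrightarrow> subsumes L \<phi> \<psi> \<Longrightarrow>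
    subsumes L (rename \<phi> \<pi>) (rename \<psi> \<pi>)"
  using subsumes_rename[OF bounded stable_permutes[OF X(2,1)]] by blast

lemma canon_body:
  assumes "\<phi> \<in> fms L"
  shows "\<exists>\<pi>. \<pi> permutes X \<and> canon_body X \<phi> = canon ord L (rename \<phi> \<pi>)"
    and "\<pi> permutes X \<Longrightarrow> lang_le ord L (canon_body X \<phi>) (canon ord L (rename \<phi> \<pi>))"
proof -
  let ?S = "{canon ord L (rename \<phi> \<pi>) | \<pi>. \<pi> permutes X}"
  have sub: "?S \<subseteq> canonical" using rename_in assms by blast
  have "canon ord L (rename \<phi> id) \<in> ?S" using permutes_id by blast
  then have "?S \<noteq> {}" by blast
  \<comment> \<open>The candidates are finite in number because they are canonical formulas of
    \<open>L\<close>.\<close>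
  note * = least_wrt[OF linear_on_subset[OF linear sub] finite_subset[OF sub finite_canonical] this]
  show "\<exists>\<pi>. \<pi> permutes X \<and> canon_body X \<phi> = canon ord L (rename \<phi> \<pi>)"
    using *(1) unfolding canon_body_def by blast
  show "\<pi> permutes X \<Longrightarrow> lang_le ord L (canon_body X \<phi>) (canon ord L (rename \<phi> \<pi>))"
    using *(2) unfolding canon_body_def by blast
qed

lemma canon_body_canonical: "\<phi> \<in> fms L \<Longrightarrow> canon_body X \<phi> \<in> canonical"
  using canon_body(1)[of \<phi>] rename_in[of _ \<phi>] by auto

lemma canon_body_subsumes:
  "\<phi> \<in> fms L \<Longrightarrow> \<exists>\<pi>. \<pi> permutes X \<and> subsumes L (canon_body X \<phi>) (rename \<phi> \<pi>)"
  using canon_body(1)[of \<phi>] rename_in[of _ \<phi>] canon_subsumes by force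

text \<open>The renamed body \<phi>\<pi> is below its canonical form; renaming both sides by the
  inverse of \<pi> restores \<phi> on the left.\<close>

lemma subsumes_canon_body:
  assumes "\<phi> \<in> fms L"
  shows "\<exists>\<pi>. \<pi> permutes X \<and> subsumes L \<phi> (rename (canon_body X \<phi>) \<pi>)"
proof -
  obtain \<pi> where \<pi>: "\<pi> permutes X" "canon_body X \<phi> = canon ord L (rename \<phi> \<pi>)"
    using canon_body(1)[OF assms] by blast
  have "subsumes L (rename \<phi> \<pi>) (canon_body X \<phi>)"
    using \<pi> subsumes_canon rename_in assms by simp
  then have "subsumes L (rename (rename \<phi> \<pi>) (inv \<pi>)) (rename (canon_body X \<phi>) (inv \<pi>))"
    using \<pi> assms canon_in rename_in permutes_inv by (intro rename_mono) auto
  then show ?thesis using rename_inv[OF \<pi>(1) assms] permutes_inv[OF \<pi>(1)] by auto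
qed

text \<open>If \<open>c\<^sub>\<phi> \<sqsubseteq> c\<^sub>\<psi> \<pi>\<close> for the canonical bodies, then \<open>c\<^sub>\<phi> \<pi>\<inverse> \<sqsubseteq> c\<^sub>\<psi>\<close>, and the canonical form of \<open>c\<^sub>\<phi> \<pi>\<inverse>\<close>
  is one of the candidates among which \<open>c\<^sub>\<phi>\<close> is least.\<close>

lemma canon_body_le:
  assumes "\<phi> \<in> fms L" "\<psi> \<in> fms L" "\<pi> permutes X"
    and "subsumes L (canon_body X \<phi>) (rename (canon_body X \<psi>) \<pi>)"
  shows "lang_le ord L (canon_body X \<phi>) (canon_body X \<psi>)"
proof -
  note inv = permutes_inv[OF assms(3)]
  note c\<phi> = canon_body_canonical[OF assms(1)] and c\<psi> = canon_body_canonical[OF assms(2)]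
  note f\<phi> = canonical_in[OF c\<phi>] and f\<psi> = canonical_in[OF c\<psi>]
  obtain \<sigma> where \<sigma>: "\<sigma> permutes X" "canon_body X \<phi> = canon ord L (rename \<phi> \<sigma>)"
    using canon_body(1)[OF assms(1)] by blast
  let ?\<chi> = "rename (canon_body X \<phi>) (inv \<pi>)" and ?\<phi>' = "rename (rename \<phi> \<sigma>) (inv \<pi>)"
  have f\<sigma>: "rename \<phi> \<sigma> \<in> fms L" using rename_in \<sigma>(1) assms(1) by blast
  have in': "?\<chi> \<in> fms L" "?\<phi>' \<in> fms L" using rename_in inv f\<phi> f\<sigma> by blast+
  \<comment> \<open>\<open>?\<chi>\<close> renames a canonical form, so it is not itself a renaming
    of \<phi>. It is equivalent to \<open>?\<phi>'\<close>, which is one, and equivalent formulas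
    share their canonical form.\<close>
  have "canon ord L ?\<chi> = canon ord L ?\<phi>'"
  proof (rule canon_eq[OF in'])
    show "subsumes L ?\<chi> ?\<phi>'" "subsumes L ?\<phi>' ?\<chi>"
      using canon_subsumes[OF f\<sigma>] subsumes_canon[OF f\<sigma>] \<sigma>(2) f\<phi> f\<sigma> by (auto intro: rename_mono[OF inv])
  qed
  also have "?\<phi>' = rename \<phi> (inv \<pi> \<circ> \<sigma>)" using rename_comp \<sigma>(1) assms(1) by blast
  finally have le: "lang_le ord L (canon_body X \<phi>) (canon ord L ?\<chi>)"
    using canon_body(2)[OF assms(1) permutes_compose[OF \<sigma>(1) inv]] by simp
  have "subsumes L ?\<chi> (rename (rename (canon_body X \<psi>) \<pi>) (inv \<pi>))"
    using rename_mono[OF inv f\<phi> _ assms(4)] rename_in assms(3) f\<psi> by blast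
  then have "subsumes L ?\<chi> (canon_body X \<psi>)" using rename_inv assms(3) f\<psi> by simp
  then have "subsumes L (canon ord L ?\<chi>) (canon_body X \<psi>)"
    using trans[OF canon_subsumes] canon_in in'(1) f\<psi> by blast
  then have "lang_le ord L (canon ord L ?\<chi>) (canon_body X \<psi>)"
    using subsumes_imp_le in'(1) c\<psi> by blast
  then show ?thesis using linear_on_trans[OF linear le] c\<phi> c\<psi> in'(1) by blast
qed

end

end

section \<open>Preservation by each language constructor\<close>

lemma canonizing_LBase:
  assumes "base_orders Sg V ord" "bounded_language Sg V (LBase A)"
  shows "canonizing_language Sg V ord (LBase A)"
proof -
  have A: "atom_set Sg V A" using assms(2) by simp
  then have ord: "linear_order_on (fms (LBase A)) (ord A)"
    "\<forall>\<phi>\<in>fms (LBase A). \<forall>\<psi>\<in>fms (LBase A). subsumes (LBase A) \<phi> \<psi> \<longrightarrow> (\<phi>, \<psi>) \<in> ord A"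
    using assms(1) unfolding base_orders_def by blast+
  have canonical: "canon ord (LBase A) ` fms (LBase A) = fms (LBase A)" by simp
  show ?thesis
  proof (unfold_locales, goal_cases)
    case 1
    show ?case by (rule assms(2))
  next
    case 2
    show ?case using A by (simp add: atom_set_def)
  next
    case 3
    have lin: "total_on (fms (LBase A)) (ord A)" "refl_on (fms (LBase A)) (ord A)"
      "antisym (ord A)" "trans (ord A)"
      using ord(1) by (auto simp: linear_order_on_def partial_order_on_def preorder_on_def)
    show ?case
      unfolding linear_on_def canonical lang_le.simps
    proof (intro conjI ballI impI)
      fix \<phi> \<psi> assume "\<phi> \<in> fms (LBase A)" "\<psi> \<in> fms (LBase A)"
      then show "(\<phi>, \<psi>) \<in> ord A \<or> (\<psi>, \<phi>) \<in> ord A"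
        using lin(1,2) unfolding total_on_def refl_on_def by (cases "\<phi> = \<psi>") blast+
    qed (use lin(3,4) in \<open>auto dest: antisymD transD\<close>)
  next
    case (7 \<phi> \<psi>)
    then show ?case using ord(2) unfolding canonical lang_le.simps by blast
  qed (simp_all add: subsumes_refl)
qed

text \<open>Finiteness and linearity pass to subsets, so enclosing the canonical formulas in the
  image of a product suffices. The other constructors use the same device with their own enclosing
  sets.\<close>

lemma canonizing_LOr:
  assumes "canonizing_language Sg V ord L1" "canonizing_language Sg V ord L2"
  shows "canonizing_language Sg V ord (LOr L1 L2)"
proof -
  interpret L1: canonizing_language Sg V ord L1 by fact
  interpret L2: canonizing_language Sg V ord L2 by fact
  let ?f = "\<lambda>p. Or (fst p) (snd p)"
  have sub: "canon ord (LOr L1 L2) ` fms (LOr L1 L2) \<subseteq> ?f ` (L1.canonical \<times> L2.canonical)"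
    by (auto intro!: image_eqI[where x = "(_, _)"])
  have lin: "linear_on (?f ` (L1.canonical \<times> L2.canonical)) (lang_le ord (LOr L1 L2))"
    by (rule linear_on_image[OF linear_on_lex_prod[OF L1.linear L2.linear]]) simp
  show ?thesis
  proof (unfold_locales, goal_cases)
    case 1
    show ?case using L1.bounded L2.bounded by simp
  next
    case 2
    show ?case
      by (rule finite_subset[OF sub]) (simp add: L1.finite_canonical L2.finite_canonical)
  next
    case 3
    show ?case by (rule linear_on_subset[OF lin sub])
  next
    case (7 \<phi> \<psi>)
    then show ?case by (auto simp: L1.subsumes_imp_le L2.subsumes_imp_le)
  qed (auto simp: L1.canon_in L2.canon_in L1.canon_subsumes L2.canon_subsumes
      L1.subsumes_canon L2.subsumes_canon)
qed

lemma canonizing_LAnd: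
  assumes "canonizing_language Sg V ord L1" "canonizing_language Sg V ord L2"
  shows "canonizing_language Sg V ord (LAnd L1 L2)"
proof -
  interpret L1: canonizing_language Sg V ord L1 by fact
  interpret L2: canonizing_language Sg V ord L2 by fact
  let ?f = "\<lambda>p. And (fst p) (snd p)"
  have sub: "canon ord (LAnd L1 L2) ` fms (LAnd L1 L2) \<subseteq> ?f ` (L1.canonical \<times> L2.canonical)"
    by (auto intro!: image_eqI[where x = "(_, _)"])
  have lin: "linear_on (?f ` (L1.canonical \<times> L2.canonical)) (lang_le ord (LAnd L1 L2))"
    by (rule linear_on_image[OF linear_on_lex_prod[OF L1.linear L2.linear]]) simp
  show ?thesis
  proof (unfold_locales, goal_cases)
    case 1
    show ?case using L1.bounded L2.bounded by simp
  next
    case 2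
    show ?case
      by (rule finite_subset[OF sub]) (simp add: L1.finite_canonical L2.finite_canonical)
  next
    case 3
    show ?case by (rule linear_on_subset[OF lin sub])
  next
    case (7 \<phi> \<psi>)
    then show ?case by (auto simp: L1.subsumes_imp_le L2.subsumes_imp_le)
  qed (auto simp: L1.canon_in L2.canon_in L1.canon_subsumes L2.canon_subsumes
      L1.subsumes_canon L2.subsumes_canon)
qed

text \<open>Sorting rearranges positions, so a formula and its canonical form match each other
  bijectively, and the bound k leaves finitely many canonical sequences. For the containment, an
  injective matching of sorted sequences makes each entry counted from the end at most its
  counterpart.\<close>

lemma canonizing_LBigOr:
  assumes "canonizing_language Sg V ord L"
  shows "canonizing_language Sg V ord (LBigOr k L)"
proof -
  interpret canonizing_language Sg V ord L by fact
  define c where "c \<phi>s = sort_list_wrt (lang_le ord L) (map (canon ord L) \<phi>s)" for \<phi>s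
  have canon: "canon ord (LBigOr k L) (BigOr \<phi>s) = BigOr (c \<phi>s)" for \<phi>s
    by (simp add: c_def)
  have c: "mset (c \<phi>s) = mset (map (canon ord L) \<phi>s)" "sorted_wrt (lang_le ord L) (c \<phi>s)"
    if "set \<phi>s \<subseteq> fms L" for \<phi>s
    using sort_list_wrt[of "map (canon ord L) \<phi>s" "lang_le ord L"] that
      linear_on_subset[OF linear, of "canon ord L ` set \<phi>s"]
    unfolding c_def by (simp_all add: image_mono)
  have set_c: "set (c \<phi>s) \<subseteq> canonical" and length_c: "length (c \<phi>s) = length \<phi>s"
    if "set \<phi>s \<subseteq> fms L" for \<phi>s
    using mset_eq_setD[OF c(1)[OF that]] mset_eq_length[OF c(1)[OF that]] that by auto
  have sub: "canon ord (LBigOr k L) ` fms (LBigOr k L) \<subseteq>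
      BigOr ` {\<phi>s. set \<phi>s \<subseteq> canonical \<and> length \<phi>s \<le> k}"
    using set_c length_c by (auto simp del: canon.simps simp: canon)
  have lin: "linear_on ((\<lambda>\<phi>s. BigOr (rev \<phi>s)) ` lists canonical) (lang_le ord (LBigOr k L))"
    by (rule linear_on_image[OF linear_on_lexle[OF linear]]) (simp add: lexle_def suffix_to_prefix)
  have lists: "BigOr ` {\<phi>s. set \<phi>s \<subseteq> canonical \<and> length \<phi>s \<le> k} \<subseteq>
      (\<lambda>\<phi>s. BigOr (rev \<phi>s)) ` lists canonical"
    by (auto intro!: image_eqI[where x = "rev _"])
  \<comment> \<open>Equality of multisets gives a permutation of positions; it and its inverse are
    the matchings for the two directions of the equivalence.\<close>
  have bij: "\<exists>p. bij_betw p {..<length \<phi>s} {..<length \<phi>s} \<and>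
      (\<forall>i<length \<phi>s. canon ord L (\<phi>s ! i) = c \<phi>s ! p i)" if mem: "set \<phi>s \<subseteq> fms L" for \<phi>s
  proof -
    obtain p where p: "p permutes {..<length (c \<phi>s)}" "permute_list p (c \<phi>s) = map (canon ord L) \<phi>s"
      by (rule mset_eq_permutation[OF c(1)[OF mem, symmetric]])
    have "canon ord L (\<phi>s ! i) = c \<phi>s ! p i" if "i < length \<phi>s" for i
      using permute_list_nth[OF p(1), of i] that length_c[OF mem] by (simp add: p(2))
    then show ?thesis using permutes_imp_bij[OF p(1)] length_c[OF mem] by auto
  qed
  show ?thesis
  proof (unfold_locales, goal_cases)
    case 1
    show ?case using bounded by simp
  next
    case 2
    show ?case
      by (rule finite_subset[OF sub]) (intro finite_imageI finite_lists_length_le finite_canonical)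
  next
    case 3
    show ?case by (rule linear_on_subset[OF linear_on_subset[OF lin lists] sub])
  next
    case (4 \<phi>)
    then obtain \<phi>s where \<phi>: "\<phi> = BigOr \<phi>s" "set \<phi>s \<subseteq> fms L" "length \<phi>s \<le> k" by auto
    then have "set (c \<phi>s) \<subseteq> fms L" using set_c canonical_in by blast
    then show ?case using \<phi> length_c[OF \<phi>(2)] unfolding \<phi>(1) canon by simp
  next
    case (5 \<phi>)
    then obtain \<phi>s where \<phi>: "\<phi> = BigOr \<phi>s" "set \<phi>s \<subseteq> fms L" "length \<phi>s \<le> k" by auto
    obtain p where p: "bij_betw p {..<length \<phi>s} {..<length \<phi>s}"
      "\<forall>i<length \<phi>s. canon ord L (\<phi>s ! i) = c \<phi>s ! p i" using bij[OF \<phi>(2)] by blast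
    let ?q = "the_inv_into {..<length \<phi>s} p"
    have q: "bij_betw ?q {..<length \<phi>s} {..<length \<phi>s}" by (rule bij_betw_the_inv_into[OF p(1)])
    have "?q i < length \<phi>s \<and> subsumes L (c \<phi>s ! i) (\<phi>s ! ?q i)" if "i < length \<phi>s" for i
    proof -
      have i: "?q i < length \<phi>s" using q that by (auto simp: bij_betw_def)
      moreover have "p (?q i) = i"
        using p(1) that by (intro f_the_inv_into_f_bij_betw) auto
      ultimately have "c \<phi>s ! i = canon ord L (\<phi>s ! ?q i)" using p(2) by simp
      then show ?thesis using i canon_subsumes[OF subsetD[OF \<phi>(2) nth_mem[OF i]]] by simp
    qed
    then show ?case
      using bij_betw_imp_inj_on[OF q] length_c[OF \<phi>(2)] unfolding \<phi>(1) canon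
      by (auto intro!: exI[of _ ?q])
  next
    case (6 \<phi>)
    then obtain \<phi>s where \<phi>: "\<phi> = BigOr \<phi>s" "set \<phi>s \<subseteq> fms L" "length \<phi>s \<le> k" by auto
    obtain p where p: "bij_betw p {..<length \<phi>s} {..<length \<phi>s}"
      "\<forall>i<length \<phi>s. canon ord L (\<phi>s ! i) = c \<phi>s ! p i" using bij[OF \<phi>(2)] by blast
    have "p i < length \<phi>s \<and> subsumes L (\<phi>s ! i) (c \<phi>s ! p i)" if "i < length \<phi>s" for i
      using p that subsumes_canon[OF subsetD[OF \<phi>(2) nth_mem[OF that]]] by (auto simp: bij_betw_def)
    then show ?case
      using bij_betw_imp_inj_on[OF p(1)] length_c[OF \<phi>(2)] unfolding \<phi>(1) canon
      by (auto intro!: exI[of _ p])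
  next
    case (7 \<phi> \<psi>)
    then obtain as bs where \<phi>: "\<phi> = BigOr (c as)" "set as \<subseteq> fms L"
      and \<psi>: "\<psi> = BigOr (c bs)" "set bs \<subseteq> fms L"
      by (auto simp del: canon.simps simp: canon)
    let ?xs = "c as" and ?ys = "c bs"
    obtain m where m: "inj_on m {..<length ?xs}"
      "\<forall>i<length ?xs. m i < length ?ys \<and> subsumes L (?xs ! i) (?ys ! m i)"
      using 7(3) \<phi>(1) \<psi>(1) by auto
    have x: "?xs ! i \<in> canonical" if "i < length ?xs" for i
      using set_c[OF \<phi>(2)] nth_mem[OF that] by blast
    have y: "?ys ! i \<in> canonical" if "i < length ?ys" for i
      using set_c[OF \<psi>(2)] nth_mem[OF that] by blast
    have le_m: "lang_le ord L (?xs ! i) (?ys ! m i)" if "i < length ?xs" for i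
      using subsumes_imp_le[OF x[OF that] y] m(2) that by blast
    note mono = linear_on_sorted_nth[OF linear]
    have len: "length ?xs \<le> length ?ys"
      using card_inj_on_le[OF m(1), of "{..<length ?ys}"] m(2) by auto
    have "lang_le ord L (rev ?xs ! i) (rev ?ys ! i)" if i: "i < length ?xs" for i
    proof -
      txt \<open>Of the \<open>i + 1\<close> largest entries of \<open>?xs\<close>, at least one is matched with an entry
        of \<open>?ys\<close> that is not among its \<open>i\<close> largest.\<close>
      let ?I = "{length ?xs - Suc i..<length ?xs}" and ?J = "{length ?ys - i..<length ?ys}"
      have "\<exists>j\<in>?I. m j \<notin> ?J"
      proof (rule ccontr)
        assume "\<not> (\<exists>j\<in>?I. m j \<notin> ?J)"
        moreover have "inj_on m ?I" using m(1) by (rule inj_on_subset) auto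
        ultimately have "card ?I \<le> card ?J" by (intro card_inj_on_le[of m]) auto
        then show False using i len by simp
      qed
      then obtain j where j: "length ?xs - Suc i \<le> j" "j < length ?xs" "m j \<notin> ?J" by auto
      then have mj: "m j \<le> length ?ys - Suc i" "m j < length ?ys" using m(2) by force+
      \<comment> \<open>Sortedness bounds the entry of \<open>?xs\<close> by \<open>?xs ! j\<close>,
        subsumption bounds that by its match \<open>?ys ! m j\<close>, and sortedness bounds the
        match by the entry of \<open>?ys\<close>.\<close>
      have "lang_le ord L (?xs ! (length ?xs - Suc i)) (?xs ! j)"
        using mono[OF set_c[OF \<phi>(2)] c(2)[OF \<phi>(2)]] j by blast
      moreover have "lang_le ord L (?ys ! m j) (?ys ! (length ?ys - Suc i))"
        using mono[OF set_c[OF \<psi>(2)] c(2)[OF \<psi>(2)] mj(1)] i len by simp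
      moreover have "length ?xs - Suc i < length ?xs" "length ?ys - Suc i < length ?ys"
        using i len by simp_all
      ultimately have "lang_le ord L (?xs ! (length ?xs - Suc i)) (?ys ! (length ?ys - Suc i))"
        by (meson linear_on_trans[OF linear] le_m[OF j(2)] x[OF j(2)] y[OF mj(2)] x y)
      then show ?thesis using i len by (simp add: rev_nth)
    qed
    then have "lexle (lang_le ord L) (rev ?xs) (rev ?ys)" using len by (intro lexle_pointwise) auto
    then show ?case unfolding \<phi>(1) \<psi>(1) by (simp add: lexle_def suffix_to_prefix)
  qed
qed

text \<open>Dropping conjuncts preserves equivalence because each has a retained one below it.
  Lengths are unbounded, but canonical sequences are duplicate-free over a finite set. The
  containment rests on these sequences being ascending antichains.\<close>

lemma canonizing_LBigAnd:
  assumes "canonizing_language Sg V ord L"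
  shows "canonizing_language Sg V ord (LBigAnd L)"
proof -
  interpret canonizing_language Sg V ord L by fact
  define c where
    "c \<phi>s = sort_set_wrt (lang_le ord L) (minimals (subsumes L) (canon ord L ` set \<phi>s))" for \<phi>s
  have canon: "canon ord (LBigAnd L) (BigAnd \<phi>s) = BigAnd (c \<phi>s)" for \<phi>s
    by (simp add: c_def)
  have min: "minimals (subsumes L) (canon ord L ` set \<phi>s) \<subseteq> canonical" if "set \<phi>s \<subseteq> fms L" for \<phi>s
    using that by (auto simp: minimals_def)
  have c: "set (c \<phi>s) = minimals (subsumes L) (canon ord L ` set \<phi>s)" "distinct (c \<phi>s)"
    "sorted_wrt (lang_le ord L) (c \<phi>s)" if "set \<phi>s \<subseteq> fms L" for \<phi>s
    using sort_set_wrt[OF linear_on_subset[OF linear min[OF that]]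
        finite_subset[OF min[OF that] finite_canonical]]
    unfolding c_def by auto
  have set_c: "set (c \<phi>s) \<subseteq> canonical" if "set \<phi>s \<subseteq> fms L" for \<phi>s
    unfolding c(1)[OF that] by (rule min[OF that])
  have c_below: "\<exists>\<psi>\<in>set (c \<phi>s). subsumes L \<psi> \<phi>"
    if mem: "set \<phi>s \<subseteq> fms L" "\<phi> \<in> set \<phi>s" for \<phi>s \<phi>
  proof -
    have \<phi>: "\<phi> \<in> fms L" using mem by auto
    obtain \<psi> where \<psi>: "\<psi> \<in> set (c \<phi>s)" "subsumes L \<psi> (canon ord L \<phi>)"
      using minimal_below[of "canon ord L ` set \<phi>s" "canon ord L \<phi>"] mem c(1)[OF mem(1)] by auto
    then have "\<psi> \<in> fms L" using set_c[OF mem(1)] canonical_in by auto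
    then have "subsumes L \<psi> \<phi>"
      by (intro trans[OF \<psi>(2) canon_subsumes[OF \<phi>]] canon_in \<phi>)
    then show ?thesis using \<psi>(1) by blast
  qed
  have c_above: "\<exists>\<psi>\<in>set \<phi>s. subsumes L \<psi> \<phi>" if "set \<phi>s \<subseteq> fms L" "\<phi> \<in> set (c \<phi>s)" for \<phi>s \<phi>
    using that(2) subsumes_canon that(1) unfolding c(1)[OF that(1)] minimals_def by auto
  have subsumesI: "subsumes (LBigAnd L) (BigAnd \<phi>s) (BigAnd \<psi>s)"
    if below: "\<forall>\<psi>\<in>set \<psi>s. \<exists>\<phi>\<in>set \<phi>s. subsumes L \<phi> \<psi>" for \<phi>s \<psi>s
  proof -
    have "\<exists>j. i < length \<psi>s \<longrightarrow> j < length \<phi>s \<and> subsumes L (\<phi>s ! j) (\<psi>s ! i)" for i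
    proof (cases "i < length \<psi>s")
      case True
      then obtain \<phi> where "\<phi> \<in> set \<phi>s" "subsumes L \<phi> (\<psi>s ! i)" using below nth_mem by blast
      then show ?thesis by (auto simp: in_set_conv_nth)
    qed simp
    then have "\<forall>i. \<exists>j. i < length \<psi>s \<longrightarrow> j < length \<phi>s \<and> subsumes L (\<phi>s ! j) (\<psi>s ! i)" by blast
    then have "\<exists>m. \<forall>i. i < length \<psi>s \<longrightarrow> m i < length \<phi>s \<and> subsumes L (\<phi>s ! m i) (\<psi>s ! i)"
      by (rule choice)
    then show ?thesis by auto
  qed
  have sub: "canon ord (LBigAnd L) ` fms (LBigAnd L) \<subseteq>
      BigAnd ` {\<phi>s. set \<phi>s \<subseteq> canonical \<and> distinct \<phi>s}"
    using set_c c(2) by (auto simp del: canon.simps simp: canon)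
  have lin: "linear_on (BigAnd ` lists canonical) (lang_le ord (LBigAnd L))"
    by (rule linear_on_image[OF linear_on_converse[OF linear_on_lexle[OF linear_on_converse[OF linear]]]])
      (simp add: lexle_def first_diff_less_converse[of "lang_le ord L"])
  have lists: "BigAnd ` {\<phi>s. set \<phi>s \<subseteq> canonical \<and> distinct \<phi>s} \<subseteq> BigAnd ` lists canonical"
    by auto
  show ?thesis
  proof (unfold_locales, goal_cases)
    case 1
    show ?case using bounded by simp
  next
    case 2
    show ?case
      by (rule finite_subset[OF sub]) (intro finite_imageI finite_subset_distinct finite_canonical)
  next
    case 3
    show ?case by (rule linear_on_subset[OF linear_on_subset[OF lin lists] sub])
  next
    case (4 \<phi>)
    then obtain \<phi>s where \<phi>: "\<phi> = BigAnd \<phi>s" "set \<phi>s \<subseteq> fms L" "\<phi>s \<noteq> []" by auto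
    have "set (c \<phi>s) \<subseteq> fms L" using set_c[OF \<phi>(2)] canonical_in by auto
    \<comment> \<open>Some retained conjunct lies below the head, so the canonical conjunction is
      not empty.\<close>
    moreover have "c \<phi>s \<noteq> []" using c_below[OF \<phi>(2) hd_in_set[OF \<phi>(3)]] by auto
    ultimately show ?case unfolding \<phi>(1) canon by simp
  next
    case (5 \<phi>)
    then obtain \<phi>s where \<phi>: "\<phi> = BigAnd \<phi>s" "set \<phi>s \<subseteq> fms L" by auto
    then show ?case unfolding \<phi>(1) canon by (intro subsumesI ballI c_below)
  next
    case (6 \<phi>)
    then obtain \<phi>s where \<phi>: "\<phi> = BigAnd \<phi>s" "set \<phi>s \<subseteq> fms L" by auto
    then show ?case unfolding \<phi>(1) canon by (intro subsumesI ballI c_above)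
  next
    case (7 \<phi> \<psi>)
    then obtain as bs where \<phi>: "\<phi> = BigAnd (c as)" "set as \<subseteq> fms L"
      and \<psi>: "\<psi> = BigAnd (c bs)" "set bs \<subseteq> fms L"
      by (auto simp del: canon.simps simp: canon)
    let ?xs = "c as" and ?ys = "c bs" and ?le = "\<lambda>\<phi> \<psi>. lang_le ord L \<psi> \<phi>"
    obtain m where m: "\<forall>i<length ?ys. m i < length ?xs \<and> subsumes L (?xs ! m i) (?ys ! i)"
      using 7(3) \<phi>(1) \<psi>(1) by auto
    have x: "?xs ! i \<in> canonical" if "i < length ?xs" for i
      using set_c[OF \<phi>(2)] nth_mem[OF that] by blast
    have y: "?ys ! i \<in> canonical" if "i < length ?ys" for i
      using set_c[OF \<psi>(2)] nth_mem[OF that] by blast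
    have antichain: "i = j" if "subsumes L (?ys ! i) (?ys ! j)" "i < length ?ys" "j < length ?ys" for i j
    proof -
      have "?ys ! i \<in> minimals (subsumes L) (canon ord L ` set bs)"
        "?ys ! j \<in> minimals (subsumes L) (canon ord L ` set bs)"
        using nth_mem[OF that(2)] nth_mem[OF that(3)] c(1)[OF \<psi>(2)] by auto
      then have "?ys ! i = ?ys ! j" using that(1) unfolding minimals_def by blast
      then show ?thesis using nth_eq_iff_index_eq[OF c(2)[OF \<psi>(2)]] that(2,3) by blast
    qed
    have "lexle ?le ?ys ?xs"
    proof (rule ccontr)
      assume *: "\<not> lexle ?le ?ys ?xs"
      have lists: "?xs \<in> lists canonical" "?ys \<in> lists canonical"
        using set_c[OF \<phi>(2)] set_c[OF \<psi>(2)] by auto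
      \<comment> \<open>By totality, failure of the claim means that the opposite comparison holds,
        with either a prefix or a first difference.\<close>
      have "lexle ?le ?xs ?ys"
        using linear_on_total[OF linear_on_lexle[OF linear_on_converse[OF linear]] lists] * by blast
      then consider "prefix ?xs ?ys" | "first_diff_less (lang_le ord L) ?ys ?xs"
        unfolding lexle_def first_diff_less_converse[of "lang_le ord L"] by blast
      then show False
      proof cases
        case 1
        then obtain zs where zs: "?ys = ?xs @ zs" by (rule prefixE)
        \<comment> \<open>The first entry of \<open>?ys\<close> beyond \<open>?xs\<close> has an
          entry of \<open>?xs\<close> below it. That is an earlier entry of \<open>?ys\<close>,
          against the antichain property.\<close>
        have "?ys \<noteq> ?xs" using * by (auto simp: lexle_def)
        then have i: "length ?xs < length ?ys" using zs by simp
        then have mi: "m (length ?xs) < length ?xs"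
          "subsumes L (?xs ! m (length ?xs)) (?ys ! length ?xs)" using m by blast+
        then have "subsumes L (?ys ! m (length ?xs)) (?ys ! length ?xs)"
          using zs by (simp add: nth_append)
        then show False using antichain[OF _ _ i] mi(1) i by fastforce
      next
        case 2
        then obtain i where i: "i < length ?ys" "i < length ?xs" "\<forall>j<i. ?ys ! j = ?xs ! j"
          "?ys ! i \<noteq> ?xs ! i" "lang_le ord L (?ys ! i) (?xs ! i)"
          unfolding first_diff_less_def by blast
        have mi: "m i < length ?xs" "subsumes L (?xs ! m i) (?ys ! i)" using m i(1) by blast+
        \<comment> \<open>Before i the sequences agree, so m i < i would put one entry of
          \<open>?ys\<close> below another. Hence m i is at least i, and sortedness makes
          \<open>?xs ! i\<close> at most \<open>?xs ! m i\<close>, which is at most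
          \<open>?ys ! i\<close>, against the choice of i.\<close>
        have "\<not> m i < i"
        proof
          assume "m i < i"
          moreover from this have "subsumes L (?ys ! m i) (?ys ! i)" using i(3) mi(2) by simp
          ultimately show False using antichain[of "m i" i] i(1) by simp
        qed
        then have "lang_le ord L (?xs ! i) (?xs ! m i)"
          using linear_on_sorted_nth[OF linear set_c[OF \<phi>(2)] c(3)[OF \<phi>(2)]] mi(1) by simp
        moreover have "lang_le ord L (?xs ! m i) (?ys ! i)"
          by (rule subsumes_imp_le[OF x[OF mi(1)] y[OF i(1)] mi(2)])
        ultimately have "lang_le ord L (?xs ! i) (?ys ! i)"
          by (rule linear_on_trans[OF linear]) (intro x y i mi)+
        then show False
          using linear_on_antisym[OF linear _ _ y[OF i(1)] x[OF i(2)]] i(4,5) by blast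
      qed
    qed
    then show ?case unfolding \<phi>(1) \<psi>(1)
      by (simp add: lexle_def first_diff_less_converse[of "lang_le ord L"])
  qed
qed

lemma canonizing_LEx:
  assumes "canonizing_language Sg V ord L" "bounded_language Sg V (LEx X L)"
  shows "canonizing_language Sg V ord (LEx X L)"
proof -
  interpret canonizing_language Sg V ord L by fact
  have X: "finite X" "perm_closed X (fms L)" using assms(2) by auto
  have canon: "canon ord (LEx X L) (Exists X \<phi>) = Exists X (canon_body X \<phi>)" for \<phi>
    by (simp add: canon_body_def)
  have sub: "canon ord (LEx X L) ` fms (LEx X L) \<subseteq> Exists X ` canonical"
    using canon_body_canonical[OF X] by (auto simp del: canon.simps simp: canon)
  have lin: "linear_on (Exists X ` canonical) (lang_le ord (LEx X L))"
    by (rule linear_on_image[OF linear]) simp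
  show ?thesis
  proof (unfold_locales, goal_cases)
    case 1
    show ?case by (rule assms(2))
  next
    case 2
    show ?case by (rule finite_subset[OF sub]) (intro finite_imageI finite_canonical)
  next
    case 3
    show ?case by (rule linear_on_subset[OF lin sub])
  next
    case (4 \<phi>)
    then obtain \<psi> where "\<phi> = Exists X \<psi>" "\<psi> \<in> fms L" by auto
    then show ?case using canonical_in[OF canon_body_canonical[OF X]] by (simp del: canon.simps add: canon)
  next
    case (5 \<phi>)
    then obtain \<psi> where "\<phi> = Exists X \<psi>" "\<psi> \<in> fms L" by auto
    then show ?case using canon_body_subsumes[OF X] by (simp del: canon.simps add: canon)
  next
    case (6 \<phi>)
    then obtain \<psi> where "\<phi> = Exists X \<psi>" "\<psi> \<in> fms L" by auto
    then show ?case using subsumes_canon_body[OF X] by (simp del: canon.simps add: canon)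
  next
    case (7 \<phi> \<psi>)
    then obtain \<phi>' \<psi>' where \<phi>: "\<phi> = Exists X (canon_body X \<phi>')" "\<phi>' \<in> fms L"
      and \<psi>: "\<psi> = Exists X (canon_body X \<psi>')" "\<psi>' \<in> fms L"
      by (auto simp del: canon.simps simp: canon)
    then show ?case using 7(3) canon_body_le[OF X \<phi>(2) \<psi>(2)] by auto
  qed
qed

lemma canonizing_LAll:
  assumes "canonizing_language Sg V ord L" "bounded_language Sg V (LAll X L)"
  shows "canonizing_language Sg V ord (LAll X L)"
proof -
  interpret canonizing_language Sg V ord L by fact
  have X: "finite X" "perm_closed X (fms L)" using assms(2) by auto
  have canon: "canon ord (LAll X L) (Forall X \<phi>) = Forall X (canon_body X \<phi>)" for \<phi>
    by (simp add: canon_body_def)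
  have sub: "canon ord (LAll X L) ` fms (LAll X L) \<subseteq> Forall X ` canonical"
    using canon_body_canonical[OF X] by (auto simp del: canon.simps simp: canon)
  have lin: "linear_on (Forall X ` canonical) (lang_le ord (LAll X L))"
    by (rule linear_on_image[OF linear]) simp
  show ?thesis
  proof (unfold_locales, goal_cases)
    case 1
    show ?case by (rule assms(2))
  next
    case 2
    show ?case by (rule finite_subset[OF sub]) (intro finite_imageI finite_canonical)
  next
    case 3
    show ?case by (rule linear_on_subset[OF lin sub])
  next
    case (4 \<phi>)
    then obtain \<psi> where "\<phi> = Forall X \<psi>" "\<psi> \<in> fms L" by auto
    then show ?case using canonical_in[OF canon_body_canonical[OF X]] by (simp del: canon.simps add: canon)
  next
    case (5 \<phi>)
    then obtain \<psi> where "\<phi> = Forall X \<psi>" "\<psi> \<in> fms L" by auto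
    then show ?case using canon_body_subsumes[OF X] by (simp del: canon.simps add: canon)
  next
    case (6 \<phi>)
    then obtain \<psi> where "\<phi> = Forall X \<psi>" "\<psi> \<in> fms L" by auto
    then show ?case using subsumes_canon_body[OF X] by (simp del: canon.simps add: canon)
  next
    case (7 \<phi> \<psi>)
    then obtain \<phi>' \<psi>' where \<phi>: "\<phi> = Forall X (canon_body X \<phi>')" "\<phi>' \<in> fms L"
      and \<psi>: "\<psi> = Forall X (canon_body X \<psi>')" "\<psi>' \<in> fms L"
      by (auto simp del: canon.simps simp: canon)
    then show ?case using 7(3) canon_body_le[OF X \<phi>(2) \<psi>(2)] by auto
  qed
qed

lemma canonizing_LExAll:
  fixes L :: "('a, 'b, 'c) lang"
  assumes "canonizing_language Sg V ord L" "bounded_language Sg V (LExAll X L)"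
  shows "canonizing_language Sg V ord (LExAll X L)"
proof -
  interpret canonizing_language Sg V ord L by fact
  have X: "finite X" "perm_closed X (fms L)" using assms(2) by auto
  \<comment> \<open>With the quantifier coded as a truth value, implication is the order that puts
    universal before existential. The order of the language then becomes a lexicographic product of
    quantifier and body, and subsumption a componentwise one.\<close>
  define Q :: "bool \<Rightarrow> ('a, 'b, 'c) fm \<Rightarrow> ('a, 'b, 'c) fm"
    where "Q ex = (if ex then Exists X else Forall X)" for ex
  have fms: "\<exists>ex \<psi>. \<phi> = Q ex \<psi> \<and> \<psi> \<in> fms L" if "\<phi> \<in> fms (LExAll X L)" for \<phi>
    using that unfolding Q_def by (force split: if_splits)
  have Q_in: "Q ex \<phi> \<in> fms (LExAll X L)" if "\<phi> \<in> fms L" for ex \<phi>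
    using that by (simp add: Q_def)
  have canon: "canon ord (LExAll X L) (Q ex \<phi>) = Q ex (canon_body X \<phi>)" for ex \<phi>
    by (simp add: Q_def canon_body_def)
  have subsumes: "subsumes (LExAll X L) (Q ex \<phi>) (Q ex' \<psi>) \<longleftrightarrow>
      (ex \<longrightarrow> ex') \<and> (\<exists>\<pi>. \<pi> permutes X \<and> subsumes L \<phi> (rename \<psi> \<pi>))" for ex ex' \<phi> \<psi>
    by (auto simp: Q_def)
  have le: "lang_le ord (LExAll X L) (Q ex \<phi>) (Q ex' \<psi>) \<longleftrightarrow>
      ex \<noteq> ex' \<and> (ex \<longrightarrow> ex') \<or> ex = ex' \<and> lang_le ord L \<phi> \<psi>" for ex ex' \<phi> \<psi>
    by (auto simp: Q_def)
  let ?f = "\<lambda>p. Q (fst p) (snd p)"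
  have sub: "canon ord (LExAll X L) ` fms (LExAll X L) \<subseteq> ?f ` (UNIV \<times> canonical)"
  proof (intro image_subsetI)
    fix \<phi> assume "\<phi> \<in> fms (LExAll X L)"
    then obtain ex \<psi> where "\<phi> = Q ex \<psi>" "\<psi> \<in> fms L" using fms by blast
    then show "canon ord (LExAll X L) \<phi> \<in> ?f ` (UNIV \<times> canonical)"
      using canon_body_canonical[OF X]
      by (auto simp del: canon.simps simp: canon intro!: image_eqI[where x = "(ex, _)"])
  qed
  have "linear_on UNIV (\<lambda>ex ex'. ex \<longrightarrow> ex')" unfolding linear_on_def by blast
  then have lin: "linear_on (?f ` (UNIV \<times> canonical)) (lang_le ord (LExAll X L))"
    by (rule linear_on_image[OF linear_on_lex_prod[OF _ linear]]) (simp only: le)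
  show ?thesis
  proof (unfold_locales, goal_cases)
    case 1
    show ?case by (rule assms(2))
  next
    case 2
    show ?case
      by (rule finite_subset[OF sub]) (intro finite_imageI finite_cartesian_product finite_canonical finite)
  next
    case 3
    show ?case by (rule linear_on_subset[OF lin sub])
  next
    case (4 \<phi>)
    then obtain ex \<psi> where \<phi>: "\<phi> = Q ex \<psi>" "\<psi> \<in> fms L" using fms by blast
    show ?case unfolding \<phi>(1) canon by (intro Q_in canonical_in canon_body_canonical[OF X] \<phi>(2))
  next
    case (5 \<phi>)
    then obtain ex \<psi> where \<phi>: "\<phi> = Q ex \<psi>" "\<psi> \<in> fms L" using fms by blast
    show ?case unfolding \<phi>(1) canon subsumes using canon_body_subsumes[OF X \<phi>(2)] by blast
  next
    case (6 \<phi>)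
    then obtain ex \<psi> where \<phi>: "\<phi> = Q ex \<psi>" "\<psi> \<in> fms L" using fms by blast
    show ?case unfolding \<phi>(1) canon subsumes using subsumes_canon_body[OF X \<phi>(2)] by blast
  next
    case (7 \<phi> \<psi>)
    from 7(1) obtain \<phi>0 where "\<phi>0 \<in> fms (LExAll X L)" "\<phi> = canon ord (LExAll X L) \<phi>0" by blast
    with fms canon obtain ex \<phi>' where \<phi>: "\<phi> = Q ex (canon_body X \<phi>')" "\<phi>' \<in> fms L" by metis
    from 7(2) obtain \<psi>0 where "\<psi>0 \<in> fms (LExAll X L)" "\<psi> = canon ord (LExAll X L) \<psi>0" by blast
    with fms canon obtain ex' \<psi>' where \<psi>: "\<psi> = Q ex' (canon_body X \<psi>')" "\<psi>' \<in> fms L" by metis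
    from 7(3) show ?case
      unfolding \<phi>(1) \<psi>(1) subsumes le using canon_body_le[OF X \<phi>(2) \<psi>(2)] by blast
  qed
qed

section \<open>All bounded languages, and the representation of a set\<close>

lemma canonizing_bounded_language:
  assumes "base_orders Sg V ord" "bounded_language Sg V L"
  shows "canonizing_language Sg V ord L"
  using assms(2)
proof (induction L)
  case (LBase A)
  then show ?case by (intro canonizing_LBase assms(1))
next
  case (LOr L1 L2)
  then show ?case by (intro canonizing_LOr) simp_all
next
  case (LAnd L1 L2)
  then show ?case by (intro canonizing_LAnd) simp_all
next
  case (LBigOr k L)
  then show ?case by (intro canonizing_LBigOr) simp
next
  case (LBigAnd L)
  then show ?case by (intro canonizing_LBigAnd) simp
next
  case (LEx X L)
  then show ?case by (intro canonizing_LEx) simp_all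
next
  case (LAll X L)
  then show ?case by (intro canonizing_LAll) simp_all
next
  case (LExAll X L)
  then show ?case by (intro canonizing_LExAll) simp_all
qed

theorem theorem3:
  fixes Sg :: "('f, 'p) signature"
    and V :: "'v set"
    and ord :: "('f, 'p, 'v) fm set \<Rightarrow> ('f, 'p, 'v) fm rel"
    and L :: "('f, 'p, 'v) lang"
    and F :: "('f, 'p, 'v) fm set"
  assumes "base_orders Sg V ord"
    and "bounded_language Sg V L"
    and "F \<subseteq> fms L"
  shows "(\<forall>s :: ('f, 'p, 'u) struct \<times> ('v \<Rightarrow> 'u). is_state Sg V s \<longrightarrow>
            ((\<forall>\<phi>\<in>representation ord L F. sat s \<phi>) \<longleftrightarrow> (\<forall>\<phi>\<in>F. sat s \<phi>)))
         \<and> up_closure L (representation ord L F) = up_closure L F"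
proof -
  interpret canonizing_language Sg V ord L by (rule canonizing_bounded_language[OF assms(1,2)])
  let ?R = "representation ord L F"
  have R: "\<exists>\<phi>\<in>F. \<psi> = canon ord L \<phi>" if "\<psi> \<in> ?R" for \<psi>
    using that unfolding representation_def minimals_def by blast
  have R_in: "\<psi> \<in> fms L" if "\<psi> \<in> ?R" for \<psi> using R[OF that] assms(3) canon_in by auto
  \<comment> \<open>Every formula of \<open>?R\<close> has one of \<open>F\<close> below it, and
    conversely. Soundness turns this into equal satisfaction, and transitivity into equal upward
    closures.\<close>
  have above: "\<exists>\<phi>\<in>F. subsumes L \<phi> \<psi>" if "\<psi> \<in> ?R" for \<psi>
    using R[OF that] assms(3) subsumes_canon by auto
  have below: "\<exists>\<psi>\<in>?R. subsumes L \<psi> \<phi>" if F: "\<phi> \<in> F" for \<phi>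
  proof -
    have \<phi>: "\<phi> \<in> fms L" using F assms(3) by auto
    have "canon ord L ` F \<subseteq> canonical" using assms(3) by auto
    then obtain \<psi> where \<psi>: "\<psi> \<in> ?R" "subsumes L \<psi> (canon ord L \<phi>)"
      using minimal_below F unfolding representation_def by blast
    have "subsumes L \<psi> \<phi>"
      by (intro trans[OF \<psi>(2) canon_subsumes[OF \<phi>]] R_in[OF \<psi>(1)] canon_in \<phi>)
    then show ?thesis using \<psi>(1) by blast
  qed
  have sat: "sat s \<psi>" if "is_state Sg V s" "\<phi> \<in> fms L" "\<psi> \<in> fms L" "subsumes L \<phi> \<psi>" "sat s \<phi>"
    for s :: "('f, 'p, 'u) struct \<times> ('v \<Rightarrow> 'u)" and \<phi> \<psi>
  proof -
    obtain M \<mu> where s: "s = (M, \<mu>)" by fastforce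
    then have "univ M \<noteq> {}" using that(1) by (simp add: is_state_def)
    from subsumes_sound[OF bounded this that(2-4)] that(5) show ?thesis by (simp add: s)
  qed
  have "(\<forall>\<phi>\<in>?R. sat s \<phi>) \<longleftrightarrow> (\<forall>\<phi>\<in>F. sat s \<phi>)" if "is_state Sg V s"
    for s :: "('f, 'p, 'u) struct \<times> ('v \<Rightarrow> 'u)"
  proof (intro iffI ballI)
    fix \<phi> assume "\<phi> \<in> F" and R: "\<forall>\<phi>\<in>?R. sat s \<phi>"
    then obtain \<psi> where "\<psi> \<in> ?R" "subsumes L \<psi> \<phi>" using below by blast
    then show "sat s \<phi>" using sat[OF that R_in] R \<open>\<phi> \<in> F\<close> assms(3) by blast
  next
    fix \<psi> assume "\<psi> \<in> ?R" and F: "\<forall>\<phi>\<in>F. sat s \<phi>"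
    then obtain \<phi> where "\<phi> \<in> F" "subsumes L \<phi> \<psi>" using above by blast
    then show "sat s \<psi>" using sat[OF that _ R_in[OF \<open>\<psi> \<in> ?R\<close>]] F assms(3) by blast
  qed
  moreover have "up_closure L ?R = up_closure L F"
  proof (intro equalityI subsetI)
    fix \<chi> assume "\<chi> \<in> up_closure L ?R"
    then obtain \<psi> where \<psi>: "\<chi> \<in> fms L" "\<psi> \<in> ?R" "subsumes L \<psi> \<chi>" unfolding up_closure_def by blast
    obtain \<phi> where \<phi>: "\<phi> \<in> F" "subsumes L \<phi> \<psi>" using above[OF \<psi>(2)] by blast
    have "subsumes L \<phi> \<chi>"
      by (intro trans[OF \<phi>(2) \<psi>(3)] subsetD[OF assms(3) \<phi>(1)] R_in[OF \<psi>(2)] \<psi>(1))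
    then show "\<chi> \<in> up_closure L F" using \<psi>(1) \<phi>(1) unfolding up_closure_def by blast
  next
    fix \<chi> assume "\<chi> \<in> up_closure L F"
    then obtain \<phi> where \<phi>: "\<chi> \<in> fms L" "\<phi> \<in> F" "subsumes L \<phi> \<chi>" unfolding up_closure_def by blast
    obtain \<psi> where \<psi>: "\<psi> \<in> ?R" "subsumes L \<psi> \<phi>" using below[OF \<phi>(2)] by blast
    have "subsumes L \<psi> \<chi>"
      by (intro trans[OF \<psi>(2) \<phi>(3)] subsetD[OF assms(3) \<phi>(2)] R_in[OF \<psi>(1)] \<phi>(1))
    then show "\<chi> \<in> up_closure L ?R" using \<psi>(1) \<phi>(1) unfolding up_closure_def by blast
  qed
  ultimately show ?thesis by blast
qed

end
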